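(* Let $\mathcal{A}$ be a finite alphabet and let $\mathbf{p}$ be an irreducible pair on $\mathcal{A}$ which is (piece-wise order reversing and) of Type $\langle x\rangle$. If $\mathbf{q}$ belongs to the labeled extended Rauzy class of $\mathbf{p}$ and is of Type $\langle y\rangle$, then $x=y$.
   Context: Let $n=\#\mathcal{A}\ge2$. A pair is $\mathbf{p}=(p_0,p_1)$ with $p_0,p_1:\mathcal{A}\to\{1,\dots,n\}$ bijections (row $\varepsilon$ lists $p_\varepsilon^{-1}(1),\dots,p_\varepsilon^{-1}(n)$). Irreducible: $p_0^{-1}\{1,\dots,k\}\ne p_1^{-1}\{1,\dots,k\}$ for $1\le k<n$. Rauzy move of type $\varepsilon$: $\varepsilon\mathbf{p}=(p'_0,p'_1)$, $p'_\varepsilon=p_\varepsilon$, and for $z=p_\varepsilon^{-1}(n)$, $p'_{1-\varepsilon}(b)=p_{1-\varepsilon}(b)$ if $p_{1-\varepsilon}(b)\le p_{1-\varepsilon}(z)$, $=p_{1-\varepsilon}(b)+1$ if $p_{1-\varepsilon}(z)<p_{1-\varepsilon}(b)<n$, $=p_{1-\varepsilon}(z)+1$ if $p_{1-\varepsilon}(b)=n$. Left Rauzy move of type $\varepsilon$: $\tilde\varepsilon\mathbf{p}=(p'_0,p'_1)$, $p'_\varepsilon=p_\varepsilon$, and for $a=p_\varepsilon^{-1}(1)$, $p'_{1-\varepsilon}(b)=p_{1-\varepsilon}(a)-1$ if $p_{1-\varepsilon}(b)=1$, $=p_{1-\varepsilon}(b)-1$ if $1<p_{1-\varepsilon}(b)<p_{1-\varepsilon}(a)$,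 unchanged otherwise. The labeled extended Rauzy class of $\mathbf{p}$ is the set of pairs reachable from $\mathbf{p}$ by Rauzy and left Rauzy moves of both types. Standard: $p_0^{-1}(1)=p_1^{-1}(n)$, $p_1^{-1}(1)=p_0^{-1}(n)$. A standard pair is piece-wise order reversing if there are $2=k_0<\dots<k_\ell=n$ with $B_i=p_0^{-1}\{k_{i-1},\dots,k_i-1\}=p_1^{-1}\{k_{i-1},\dots,k_i-1\}$ and $p_0(b)+p_1(b)=k_{i-1}+k_i-1$ for $b\in B_i$; the $B_i$ are blocks ($k$-block: $k$ letters). Chains: with the $1$-blocks $S_1,\dots,S_{k-1}$ listed left to right, chain $C_i$ is the possibly empty sequence of consecutive blocks strictly between $S_{i-1}$ and $S_i$ ($C_1$ before $S_1$, $C_k$ after $S_{k-1}$). Only piece-wise order reversing pairs can have a Type. Types: $\langle1\rangle$: at most one nonempty chain, consisting (if present) of one block. Types $\langle2\rangle$–$\langle5\rangle$ require more than one block of size $\ge2$, and: $\langle2\rangle$: all nonempty chains consist of $2$-blocks; $\langle3\rangle$: each nonempty chain is (i) $m$ $2$-blocks, a $3$-block, $\ell$ $2$-blocks ($m,\ell\ge0$) or (ii) $m\ge1$ $2$-blocks, with at least one chain of form (i); $\langle4\rangle$: exactly one chain is a $4$-block followed by $m\ge0$ $2$-blocks, other nonempty chains consist of $2$-blocks; $\langle5\rangle$: exactly one chain is a single $5$-block, every other nonempty chain is exactly one $2$-block. *)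

theory Defs
  imports "HOL-Library.Cardinality"
begin

text \<open>A pair on the finite alphabet 'a (n = CARD('a) letters):
  (p0, p1), each p_e : 'a \<Rightarrow> {1..n} a bijection.
  Row e lists the letters p_e^{-1}(1), ..., p_e^{-1}(n).\<close>

type_synonym 'a pair = "('a \<Rightarrow> nat) \<times> ('a \<Rightarrow> nat)"

definition is_pair :: "'a::finite pair \<Rightarrow> bool" where
  "is_pair p \<longleftrightarrow> bij_betw (fst p) UNIV {1..CARD('a)} \<and> bij_betw (snd p) UNIV {1..CARD('a)}"

definition letter_at :: "('a \<Rightarrow> nat) \<Rightarrow> nat \<Rightarrow> 'a" where
  "letter_at r k = (THE a. r a = k)"

definition irreducible_pair :: "'a::finite pair \<Rightarrow> bool" where
  "irreducible_pair p \<longleftrightarrow>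
     (\<forall>k. 1 \<le> k \<and> k < CARD('a) \<longrightarrow>
        {b. fst p b \<in> {1..k}} \<noteq> {b. snd p b \<in> {1..k}})"

text \<open>Rauzy move: row re (the "winner" row, type e) stays; the other row ro is updated.\<close>
definition rauzy_row :: "nat \<Rightarrow> ('a \<Rightarrow> nat) \<Rightarrow> ('a \<Rightarrow> nat) \<Rightarrow> ('a \<Rightarrow> nat)" where
  "rauzy_row n re ro = (\<lambda>b. let z = letter_at re n in
      if ro b \<le> ro z then ro b
      else if ro b < n then ro b + 1
      else ro z + 1)"

definition left_rauzy_row :: "('a \<Rightarrow> nat) \<Rightarrow> ('a \<Rightarrow> nat) \<Rightarrow> ('a \<Rightarrow> nat)" where
  "left_rauzy_row re ro = (\<lambda>b. let a = letter_at re 1 in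
      if ro b = 1 then ro a - 1
      else if 1 < ro b \<and> ro b < ro a then ro b - 1
      else ro b)"

text \<open>Type 0 corresponds to e = False, type 1 to e = True.\<close>
definition rauzy_move :: "bool \<Rightarrow> 'a::finite pair \<Rightarrow> 'a pair" where
  "rauzy_move e p = (if \<not> e then (fst p, rauzy_row CARD('a) (fst p) (snd p))
                     else (rauzy_row CARD('a) (snd p) (fst p), snd p))"

definition left_rauzy_move :: "bool \<Rightarrow> 'a::finite pair \<Rightarrow> 'a pair" where
  "left_rauzy_move e p = (if \<not> e then (fst p, left_rauzy_row (fst p) (snd p))
                          else (left_rauzy_row (snd p) (fst p), snd p))"

definition ext_rauzy_step :: "'a::finite pair \<Rightarrow> 'a pair \<Rightarrow> bool" where
  "ext_rauzy_step p q \<longleftrightarrow> (\<exists>e. q = rauzy_move e p \<or> q = left_rauzy_move e p)"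

definition ext_rauzy_class :: "'a::finite pair \<Rightarrow> 'a pair set" where
  "ext_rauzy_class p = {q. ext_rauzy_step\<^sup>*\<^sup>* p q}"

definition standard_pair :: "'a::finite pair \<Rightarrow> bool" where
  "standard_pair p \<longleftrightarrow>
     letter_at (fst p) 1 = letter_at (snd p) CARD('a) \<and>
     letter_at (snd p) 1 = letter_at (fst p) CARD('a)"

definition por_decomp :: "'a::finite pair \<Rightarrow> nat list \<Rightarrow> bool" where
  "por_decomp p ks \<longleftrightarrow>
     ks \<noteq> [] \<and> hd ks = 2 \<and> last ks = CARD('a) \<and> sorted_wrt (<) ks \<and>
     (\<forall>i. 1 \<le> i \<and> i < length ks \<longrightarrow>
        {b. ks!(i-1) \<le> fst p b \<and> fst p b < ks!i} = {b. ks!(i-1) \<le> snd p b \<and> snd p b < ks!i} \<and>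
        (\<forall>b. ks!(i-1) \<le> fst p b \<and> fst p b < ks!i \<longrightarrow> fst p b + snd p b = ks!(i-1) + ks!i - 1))"

definition piecewise_order_reversing :: "'a::finite pair \<Rightarrow> bool" where
  "piecewise_order_reversing p \<longleftrightarrow> standard_pair p \<and> (\<exists>ks. por_decomp p ks)"

definition block_sizes :: "nat list \<Rightarrow> nat list" where
  "block_sizes ks = map (\<lambda>i. ks!(i+1) - ks!i) [0..<length ks - 1]"

fun chains :: "nat list \<Rightarrow> nat list list" where
  "chains [] = [[]]"
| "chains (x # xs) = (if x = 1 then [] # chains xs
                      else (case chains xs of [] \<Rightarrow> [[x]] | c # cs \<Rightarrow> (x # c) # cs))"

definition nonempty_chains :: "nat list \<Rightarrow> nat list list" where
  "nonempty_chains s = filter (\<lambda>c. c \<noteq> []) (chains s)"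

definition many_big_blocks :: "nat list \<Rightarrow> bool" where
  "many_big_blocks s \<longleftrightarrow> length (filter (\<lambda>k. 2 \<le> k) s) > 1"

definition all_twos :: "nat list \<Rightarrow> bool" where
  "all_twos c \<longleftrightarrow> (\<forall>k\<in>set c. k = 2)"

definition chain3_i :: "nat list \<Rightarrow> bool" where
  "chain3_i c \<longleftrightarrow> (\<exists>m l. c = replicate m 2 @ [3] @ replicate l 2)"

definition chain4 :: "nat list \<Rightarrow> bool" where
  "chain4 c \<longleftrightarrow> (\<exists>m. c = 4 # replicate m 2)"

definition type_sizes :: "nat \<Rightarrow> nat list \<Rightarrow> bool" where
  "type_sizes x s \<longleftrightarrow>
    (x = 1 \<and> length (nonempty_chains s) \<le> 1 \<and> (\<forall>c\<in>set (nonempty_chains s). length c = 1)) \<or>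
    (x = 2 \<and> many_big_blocks s \<and> (\<forall>c\<in>set (nonempty_chains s). all_twos c)) \<or>
    (x = 3 \<and> many_big_blocks s \<and>
       (\<forall>c\<in>set (nonempty_chains s). chain3_i c \<or> all_twos c) \<and>
       (\<exists>c\<in>set (nonempty_chains s). chain3_i c)) \<or>
    (x = 4 \<and> many_big_blocks s \<and>
       length (filter chain4 (chains s)) = 1 \<and>
       (\<forall>c\<in>set (nonempty_chains s). \<not> chain4 c \<longrightarrow> all_twos c)) \<or>
    (x = 5 \<and> many_big_blocks s \<and>
       length (filter (\<lambda>c. c = [5]) (chains s)) = 1 \<and>
       (\<forall>c\<in>set (nonempty_chains s). c \<noteq> [5] \<longrightarrow> c = [2]))"

definition has_type :: "nat \<Rightarrow> 'a::finite pair \<Rightarrow> bool" where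
  "has_type x p \<longleftrightarrow> standard_pair p \<and> (\<exists>ks. por_decomp p ks \<and> type_sizes x (block_sizes ks))"

end

(*
  Let c be the crossing relation of a pair: two letters cross if the rows order them
  differently. A Rauzy move in which z wins against l replaces e_l by e_l + e_z in F_2^A, where A
  is the alphabet and c is read as an alternating form. Three quantities survive all moves.

  (1) Whether the letters can be drawn as edges of a graph so that two letters cross iff the
      edges share exactly one end (a hyperellipticity criterion): if e_l = ij and e_z = jk, then
      e_l + e_z = ik. Type 1 has such a drawing. Two blocks of size at least 2 exclude it.
  (2) The Gauss sum of the quadratic form with polar form c and value 1 on every letter (the
      spin parity). For a standard pair it is -2 times a product over the blocks, with factors
      2, 2, 0, -4, -8 for block sizes 1, ..., 5, so it is negative for Type 2, zero for Type 3
      and positive for Types 4 and 5.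
  (3) Whether all singularities of the suspended surface have angle at most 6 pi, which holds
      for Type 5 and fails for Type 4.
*)

theory Submission
  imports Defs
begin

section \<open>Rauzy moves up to symmetry\<close>

text \<open>Swapping the rows and reversing both rows carry the four moves into one another, so only
  one of them has to be examined for each invariant. In a standard pair two letters cross each other
  and all the rest; each block is a clique, and letters of different blocks do not cross. The block
  sizes therefore determine \<open>crossing\<close> up to renaming, and the first two invariants can
  be computed from them. They agree for Types 4 and 5, so the third one has to look at the rows
  themselves. Singularities are never constructed as orbits: a colouring only has to be constant on
  each of them, and merging singularities under one colour only enlarges the classes. Hence a
  colouring with small classes exists exactly when all singularities are small. For Type 5 such a
  colouring is written down; for Type 4 every colouring is forced to give four left end points the
  same colour. The Gauss sum vanishes when the quadratic form is not zero on the radical of c, and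
  then there is no spin parity; this is what happens for Type 3.\<close>

definition swap_rows :: "'a pair \<Rightarrow> 'a pair" where
  "swap_rows p = (snd p, fst p)"

definition reflect_rows :: "'a::finite pair \<Rightarrow> 'a pair" where
  "reflect_rows p = (\<lambda>a. CARD('a) + 1 - fst p a, \<lambda>a. CARD('a) + 1 - snd p a)"

lemma letter_at_eq_iff:
  fixes r :: "'a::finite \<Rightarrow> nat"
  assumes "bij_betw r UNIV {1..CARD('a)}" "1 \<le> k" "k \<le> CARD('a)"
  shows "letter_at r k = a \<longleftrightarrow> r a = k"
proof -
  from assms obtain b where b: "r b = k"
    by (metis atLeastAtMost_iff bij_betw_imp_surj_on imageE)
  have that: "b' = b" if "r b' = k" for b'
    using assms(1) b that by (metis UNIV_I bij_betw_inv_into_left)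
  have "letter_at r k = b"
    unfolding letter_at_def using b that by blast
  with b that show ?thesis by metis
qed

lemma row_range:
  fixes r :: "'a::finite \<Rightarrow> nat"
  assumes "bij_betw r UNIV {1..CARD('a)}"
  shows "1 \<le> r a" "r a \<le> CARD('a)"
  using assms by (metis UNIV_I atLeastAtMost_iff bij_betwE)+

lemma row_eq_iff:
  fixes r :: "'a::finite \<Rightarrow> nat"
  assumes "bij_betw r UNIV {1..CARD('a)}"
  shows "r a = r b \<longleftrightarrow> a = b"
  using assms by (metis UNIV_I bij_betw_inv_into_left)

lemma row_surj:
  fixes r :: "'a::finite \<Rightarrow> nat"
  assumes "bij_betw r UNIV {1..CARD('a)}" "1 \<le> k" "k \<le> CARD('a)"
  obtains a where "r a = k"
  using letter_at_eq_iff[OF assms] by blast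

lemma bij_rowI:
  fixes r :: "'a::finite \<Rightarrow> nat"
  assumes "inj r" "\<And>a. 1 \<le> r a \<and> r a \<le> CARD('a)"
  shows "bij_betw r UNIV {1..CARD('a)}"
proof -
  have "r ` UNIV \<subseteq> {1..CARD('a)}" using assms(2) by auto
  moreover have "card (r ` UNIV) = card {1..CARD('a)}"
    using assms(1) by (simp add: card_image)
  ultimately show ?thesis
    using assms(1) by (simp add: bij_betw_def card_subset_eq)
qed

lemma is_pair_swap [simp]: "is_pair (swap_rows p) \<longleftrightarrow> is_pair p"
  by (auto simp: is_pair_def swap_rows_def)

lemma irreducible_pair_swap [simp]: "irreducible_pair (swap_rows p) \<longleftrightarrow> irreducible_pair p"
  by (auto simp: irreducible_pair_def swap_rows_def)

lemma swap_rows_swap_rows [simp]: "swap_rows (swap_rows p) = p"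
  by (simp add: swap_rows_def)

lemma bij_reflect:
  fixes r :: "'a::finite \<Rightarrow> nat"
  assumes "bij_betw r UNIV {1..CARD('a)}"
  shows "bij_betw (\<lambda>a. CARD('a) + 1 - r a) UNIV {1..CARD('a)}"
proof (rule bij_rowI)
  show "inj (\<lambda>a. CARD('a) + 1 - r a)"
  proof (rule injI)
    fix x y assume "CARD('a) + 1 - r x = CARD('a) + 1 - r y"
    then have "r x = r y"
      using row_range[OF assms, of x] row_range[OF assms, of y] by simp
    then show "x = y" using row_eq_iff[OF assms] by simp
  qed
  show "1 \<le> CARD('a) + 1 - r a \<and> CARD('a) + 1 - r a \<le> CARD('a)" for a
    using row_range[OF assms, of a] by linarith
qed

lemma is_pair_reflect: "is_pair p \<Longrightarrow> is_pair (reflect_rows p)"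
  unfolding is_pair_def reflect_rows_def fst_conv snd_conv by (blast intro: bij_reflect)

lemma reflect_reflect:
  fixes p :: "'a::finite pair"
  assumes "is_pair p"
  shows "reflect_rows (reflect_rows p) = p"
proof -
  have "CARD('a) + 1 - (CARD('a) + 1 - r a) = r a" if "bij_betw r UNIV {1..CARD('a)}"
    for r :: "'a \<Rightarrow> nat" and a
    using row_range[OF that, of a] by linarith
  then show ?thesis
    using assms unfolding reflect_rows_def is_pair_def by (simp add: prod_eq_iff)
qed

text \<open>The first k letters of a reversed row are the complement of the first n - k letters of
  the row, so the rows have a common initial set before the reversal if and only if they have one
  after it.\<close>

lemma irreducible_pair_reflect:
  fixes p :: "'a::finite pair"
  assumes "is_pair p" "irreducible_pair p"
  shows "irreducible_pair (reflect_rows p)"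
  unfolding irreducible_pair_def
proof (intro allI impI)
  fix k assume k: "1 \<le> k \<and> k < CARD('a)"
  have compl: "{b. CARD('a) + 1 - r b \<in> {1..k}} = - {b. r b \<in> {1..CARD('a) - k}}"
    if "bij_betw r UNIV {1..CARD('a)}" for r :: "'a \<Rightarrow> nat"
  proof -
    have "CARD('a) + 1 - r b \<in> {1..k} \<longleftrightarrow> \<not> r b \<in> {1..CARD('a) - k}" for b
      using row_range[OF that, of b] k by auto
    then show ?thesis by blast
  qed
  have bij: "bij_betw (fst p) UNIV {1..CARD('a)}" "bij_betw (snd p) UNIV {1..CARD('a)}"
    using assms(1) by (simp_all add: is_pair_def)
  have "1 \<le> CARD('a) - k \<and> CARD('a) - k < CARD('a)"
    using k by linarith
  then have "{b. fst p b \<in> {1..CARD('a) - k}} \<noteq> {b. snd p b \<in> {1..CARD('a) - k}}"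
    using assms(2) unfolding irreducible_pair_def by blast
  then show "{b. fst (reflect_rows p) b \<in> {1..k}} \<noteq> {b. snd (reflect_rows p) b \<in> {1..k}}"
    unfolding reflect_rows_def fst_conv snd_conv compl[OF bij(1)] compl[OF bij(2)] by blast
qed

text \<open>A common last letter would leave the same set of n - 1 letters in front of it in both
  rows.\<close>

lemma irreducible_last_neq:
  fixes p :: "'a::finite pair"
  assumes "CARD('a) \<ge> 2" "is_pair p" "irreducible_pair p"
    "fst p z = CARD('a)" "snd p l = CARD('a)"
  shows "z \<noteq> l"
proof
  assume "z = l"
  have *: "{b. r b \<in> {1..CARD('a) - 1}} = - {l}"
    if "bij_betw r UNIV {1..CARD('a)}" "r l = CARD('a)" for r :: "'a \<Rightarrow> nat"
  proof -
    have "r b \<in> {1..CARD('a) - 1} \<longleftrightarrow> b \<noteq> l" for b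
      using row_range[OF that(1), of b] row_eq_iff[OF that(1), of b l] that(2) assms(1) by auto
    then show ?thesis by blast
  qed
  have "{b. fst p b \<in> {1..CARD('a) - 1}} = {b. snd p b \<in> {1..CARD('a) - 1}}"
    using *[of "fst p"] *[of "snd p"] assms \<open>z = l\<close> unfolding is_pair_def by metis
  then show False
    using assms(1,3) unfolding irreducible_pair_def by auto
qed

section \<open>A single right move of type 0, with winner \<open>z\<close> and loser
  \<open>l\<close>\<close>

locale rauzy_setup =
  fixes t s :: "'a::finite \<Rightarrow> nat" and z l :: 'a
  assumes card_ge2: "CARD('a) \<ge> 2"
    and bij_t: "bij_betw t UNIV {1..CARD('a)}"
    and bij_s: "bij_betw s UNIV {1..CARD('a)}"
    and t_z: "t z = CARD('a)" and s_l: "s l = CARD('a)" and z_neq_l: "z \<noteq> l"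
begin

definition s' :: "'a \<Rightarrow> nat" where
  "s' b = (if b = l then s z + 1 else if s b \<le> s z then s b else s b + 1)"

lemmas t_range = row_range[OF bij_t] and s_range = row_range[OF bij_s]
  and t_eq_iff = row_eq_iff[OF bij_t] and s_eq_iff = row_eq_iff[OF bij_s]

lemma s_less: "b \<noteq> l \<Longrightarrow> s b < CARD('a)"
  using s_range[of b] s_eq_iff[of b l] s_l by auto

lemma t_less: "b \<noteq> z \<Longrightarrow> t b < CARD('a)"
  using t_range[of b] t_eq_iff[of b z] t_z by auto

lemma s_z_less: "s z < CARD('a)"
  using s_less z_neq_l by blast

lemma rauzy_row_eq: "rauzy_row CARD('a) t s = s'"
proof
  fix b
  have "letter_at t CARD('a) = z"
    using letter_at_eq_iff[OF bij_t] t_z card_ge2 by simp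
  then show "rauzy_row CARD('a) t s b = s' b"
    using s_less[of b] s_z_less s_l by (auto simp: rauzy_row_def s'_def)
qed

lemma bij_s': "bij_betw s' UNIV {1..CARD('a)}"
proof (rule bij_rowI)
  show "inj s'"
    using s_eq_iff by (auto intro!: injI simp: s'_def split: if_splits)
  show "1 \<le> s' a \<and> s' a \<le> CARD('a)" for a
    using s_range[of a] s_less[of a] s_z_less by (auto simp: s'_def)
qed

text \<open>A common initial set after the move misses \<open>z\<close>, which is last in
  \<open>t\<close>. So it ends before \<open>z\<close> in the other row, where the move changes
  nothing, and it was already common before.\<close>

lemma irreducible_move:
  assumes "irreducible_pair (t, s)"
  shows "irreducible_pair (t, s')"
  unfolding irreducible_pair_def
proof (intro allI impI notI)
  fix k assume k: "1 \<le> k \<and> k < CARD('a)"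
    and eq: "{b. fst (t, s') b \<in> {1..k}} = {b. snd (t, s') b \<in> {1..k}}"
  have "z \<notin> {b. fst (t, s') b \<in> {1..k}}" using t_z k by auto
  then have "z \<notin> {b. snd (t, s') b \<in> {1..k}}" unfolding eq .
  then have "k < s z" using s_range[of z] z_neq_l by (auto simp: s'_def)
  then have "s' b \<in> {1..k} \<longleftrightarrow> s b \<in> {1..k}" for b
    using s_l k by (auto simp: s'_def)
  then have "{b. fst (t, s) b \<in> {1..k}} = {b. snd (t, s) b \<in> {1..k}}"
    using eq unfolding fst_conv snd_conv by blast
  then show False using assms k unfolding irreducible_pair_def by blast
qed

end

lemma rauzy_setup_obtain:
  fixes p :: "'a::finite pair"
  assumes "CARD('a) \<ge> 2" "is_pair p" "irreducible_pair p"
  obtains z l where "rauzy_setup (fst p) (snd p) z l"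
proof -
  have bij: "bij_betw (fst p) UNIV {1..CARD('a)}" "bij_betw (snd p) UNIV {1..CARD('a)}"
    using assms(2) by (auto simp: is_pair_def)
  obtain z where z: "fst p z = CARD('a)"
    by (rule row_surj[OF bij(1), of "CARD('a)"]) (use assms(1) in auto)
  obtain l where l: "snd p l = CARD('a)"
    by (rule row_surj[OF bij(2), of "CARD('a)"]) (use assms(1) in auto)
  show ?thesis
    using that[of z l] irreducible_last_neq[OF assms z l] assms(1) bij z l
    by (auto simp: rauzy_setup_def)
qed

lemma rauzy_move_preserves:
  fixes p :: "'a::finite pair"
  assumes "CARD('a) \<ge> 2" "is_pair p" "irreducible_pair p"
  shows "is_pair (rauzy_move False p)" "irreducible_pair (rauzy_move False p)"
proof -
  obtain z l where "rauzy_setup (fst p) (snd p) z l"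
    using rauzy_setup_obtain[OF assms] .
  then interpret rauzy_setup "fst p" "snd p" z l .
  have "rauzy_move False p = (fst p, s')"
    by (simp add: rauzy_move_def rauzy_row_eq)
  then show "is_pair (rauzy_move False p)" "irreducible_pair (rauzy_move False p)"
    using bij_s' bij_t irreducible_move assms(3) by (auto simp: is_pair_def)
qed

lemma rauzy_move_True: "rauzy_move True p = swap_rows (rauzy_move False (swap_rows p))"
  by (simp add: rauzy_move_def swap_rows_def)

lemma left_rauzy_move_True:
  "left_rauzy_move True p = swap_rows (left_rauzy_move False (swap_rows p))"
  by (simp add: left_rauzy_move_def swap_rows_def)

lemma left_rauzy_move_False:
  fixes p :: "'a::finite pair"
  assumes "CARD('a) \<ge> 2" "is_pair p" "irreducible_pair p"
  shows "left_rauzy_move False p = reflect_rows (rauzy_move False (reflect_rows p))"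
proof -
  let ?n = "CARD('a)"
  have bij: "bij_betw (fst p) UNIV {1..?n}" "bij_betw (snd p) UNIV {1..?n}"
    using assms(2) by (auto simp: is_pair_def)
  have p': "is_pair (reflect_rows p)" "irreducible_pair (reflect_rows p)"
    using assms is_pair_reflect irreducible_pair_reflect by metis+
  obtain z l where "rauzy_setup (fst (reflect_rows p)) (snd (reflect_rows p)) z l"
    using rauzy_setup_obtain[OF assms(1) p'] .
  then interpret rauzy_setup "fst (reflect_rows p)" "snd (reflect_rows p)" z l .
  have first: "fst p z = 1" "snd p l = 1"
    using t_z s_l row_range[OF bij(1), of z] row_range[OF bij(2), of l]
    by (auto simp: reflect_rows_def)
  have "letter_at (fst p) 1 = z"
    using letter_at_eq_iff[OF bij(1)] first assms(1) by simp
  have snd_l: "snd p b = 1 \<longleftrightarrow> b = l" for b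
    using row_eq_iff[OF bij(2), of b l] first by simp
  have "left_rauzy_row (fst p) (snd p) b = ?n + 1 - s' b" for b
  proof -
    have rng: "1 \<le> snd p b" "snd p b \<le> ?n" "1 < snd p z" "snd p z \<le> ?n"
      using row_range[OF bij(2), of b] row_range[OF bij(2), of z] snd_l[of z] z_neq_l by linarith+
    consider "b = l" "snd p b = 1" | "b \<noteq> l" "1 < snd p b" "snd p b < snd p z"
      | "b \<noteq> l" "1 < snd p b" "snd p z \<le> snd p b"
      using snd_l[of b] rng by linarith
    then show ?thesis
      unfolding s'_def
      unfolding left_rauzy_row_def \<open>letter_at (fst p) 1 = z\<close> reflect_rows_def Let_def snd_conv
      by cases (use rng in simp_all)
  qed
  moreover have "rauzy_move False (reflect_rows p) = (fst (reflect_rows p), s')"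
    by (simp add: rauzy_move_def rauzy_row_eq)
  moreover have "?n + 1 - (?n + 1 - fst p b) = fst p b" for b
    using row_range[OF bij(1), of b] by simp
  ultimately show ?thesis
    by (simp add: left_rauzy_move_def reflect_rows_def fun_eq_iff)
qed

text \<open>The induction carries irreducibility along because every single move needs it: it makes
  the two last letters differ.\<close>

lemma ext_rauzy_class_invariant:
  fixes p q :: "'a::finite pair" and F :: "'a pair \<Rightarrow> 'b"
  assumes n: "CARD('a) \<ge> 2"
    and p: "is_pair p" "irreducible_pair p"
    and q: "q \<in> ext_rauzy_class p"
    and swap: "\<And>p. is_pair p \<Longrightarrow> F (swap_rows p) = F p"
    and reflect: "\<And>p. is_pair p \<Longrightarrow> F (reflect_rows p) = F p"
    and move: "\<And>p. is_pair p \<Longrightarrow> irreducible_pair p \<Longrightarrow> F (rauzy_move False p) = F p"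
  shows "F q = F p" "is_pair q"
proof -
  let ?I = "\<lambda>r. is_pair r \<and> irreducible_pair r \<and> F r = F p"
  have right: "?I (rauzy_move False r)" if "?I r" for r
    using that move rauzy_move_preserves[OF n] by auto
  have left: "?I (left_rauzy_move False r)" if r: "?I r" for r
  proof -
    have "is_pair (reflect_rows r)" "irreducible_pair (reflect_rows r)" "F (reflect_rows r) = F p"
      using r reflect is_pair_reflect irreducible_pair_reflect by metis+
    then have "?I (rauzy_move False (reflect_rows r))"
      using right by blast
    then show ?thesis
      using r reflect is_pair_reflect irreducible_pair_reflect left_rauzy_move_False[OF n] by metis
  qed
  have swapI: "?I (swap_rows r)" if "?I r" for r
    using that swap by simp
  have step': "?I r'" if "?I r" "ext_rauzy_step r r'" for r r'
  proof -
    obtain e where "r' = rauzy_move e r \<or> r' = left_rauzy_move e r"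
      using \<open>ext_rauzy_step r r'\<close> by (auto simp: ext_rauzy_step_def)
    moreover have "?I (rauzy_move e r)" "?I (left_rauzy_move e r)"
      using right[OF \<open>?I r\<close>] left[OF \<open>?I r\<close>]
        swapI[OF right[OF swapI[OF \<open>?I r\<close>]]] swapI[OF left[OF swapI[OF \<open>?I r\<close>]]]
      by (cases e; simp add: rauzy_move_True left_rauzy_move_True)+
    ultimately show ?thesis by blast
  qed
  have "ext_rauzy_step\<^sup>*\<^sup>* p q" using q by (simp add: ext_rauzy_class_def)
  then have "?I q"
  proof (induction rule: rtranclp_induct)
    case (step r r')
    then show ?case using step'[of r r'] by blast
  qed (use p in simp)
  then show "F q = F p" "is_pair q" by auto
qed

section \<open>The crossing relation\<close>

text \<open>These are the pairs with nonzero entry in the intersection matrix; signs are dropped, so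
  the relation is that matrix modulo 2.\<close>

definition crossing :: "'a pair \<Rightarrow> 'a \<Rightarrow> 'a \<Rightarrow> bool" where
  "crossing p a b \<longleftrightarrow>
     fst p a < fst p b \<and> snd p b < snd p a \<or> fst p b < fst p a \<and> snd p a < snd p b"

text \<open>The form \<open>c\<close> modulo 2 in the basis with \<open>e\<^sub>l\<close> replaced by \<open>e\<^sub>l + e\<^sub>z\<close>, assuming \<open>c l z\<close>.\<close>

definition slide :: "'a \<Rightarrow> 'a \<Rightarrow> ('a \<Rightarrow> 'a \<Rightarrow> bool) \<Rightarrow> 'a \<Rightarrow> 'a \<Rightarrow> bool" where
  "slide l z c x y =
     (if x = l \<and> y \<noteq> l \<and> y \<noteq> z then c l y \<noteq> c z y
      else if y = l \<and> x \<noteq> l \<and> x \<noteq> z then c l x \<noteq> c z x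
      else c x y)"

lemma symp_crossing: "symp (crossing p)"
  by (auto simp: symp_def crossing_def)

lemma irreflp_crossing: "irreflp (crossing p)"
  by (auto simp: irreflp_def crossing_def)

lemma crossing_swap: "crossing (swap_rows p) = crossing p"
  by (auto simp: fun_eq_iff crossing_def swap_rows_def)

lemma crossing_reflect:
  fixes p :: "'a::finite pair"
  assumes "is_pair p"
  shows "crossing (reflect_rows p) = crossing p"
proof -
  have "CARD('a) + 1 - r a < CARD('a) + 1 - r b \<longleftrightarrow> r b < r a"
    if "bij_betw r UNIV {1..CARD('a)}" for r :: "'a \<Rightarrow> nat" and a b
    using row_range[OF that, of a] row_range[OF that, of b] by linarith
  then show ?thesis
    using assms unfolding is_pair_def by (auto simp: fun_eq_iff crossing_def reflect_rows_def)
qed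

lemma symp_slide: "symp c \<Longrightarrow> symp (slide l z c)"
  by (auto simp: symp_def slide_def)

lemma irreflp_slide: "irreflp c \<Longrightarrow> irreflp (slide l z c)"
  by (auto simp: irreflp_def slide_def)

text \<open>Adding e_z to e_l twice is the identity modulo 2. This supplies the inverse direction in
  the invariance proofs.\<close>

lemma slide_slide:
  assumes "symp c" "l \<noteq> z"
  shows "slide l z (slide l z c) = c"
  using assms by (auto simp: fun_eq_iff slide_def dest: sympD)

context rauzy_setup
begin

text \<open>Let y be a third letter. As \<open>l\<close> is last in \<open>s\<close>, it crosses y
  iff it precedes y in \<open>t\<close>; as \<open>z\<close> is last in \<open>t\<close>, it crosses
  y iff it precedes y in \<open>s\<close>. After the move \<open>l\<close> stands next to
  \<open>z\<close> in the second row, so it crosses y iff exactly one of these two conditions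
  holds.\<close>

lemma crossing_move: "crossing (t, s') = slide l z (crossing (t, s))"
proof (intro ext)
  fix x y
  have l: "crossing (t, s') l y = slide l z (crossing (t, s)) l y" if "y \<noteq> l" for y
  proof (cases "y = z")
    case True
    then show ?thesis
      using z_neq_l s_z_less s_l by (auto simp: slide_def crossing_def s'_def)
  next
    case False
    have "t l < t y \<or> t y < t l" "s z < s y \<or> s y < s z"
      using t_eq_iff[of l y] s_eq_iff[of z y] False \<open>y \<noteq> l\<close> by (metis linorder_neqE_nat)+
    moreover have "t y < t z" "s y < s l"
      using t_less[OF False] t_z s_less[OF \<open>y \<noteq> l\<close>] s_l by simp_all
    ultimately show ?thesis
      using False \<open>y \<noteq> l\<close> by (auto simp: slide_def crossing_def s'_def)
  qed
  have sym: "symp (slide l z (crossing (t, s)))"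
    by (intro symp_slide symp_crossing)
  consider "x = l" "y = l" | "x = l" "y \<noteq> l" | "x \<noteq> l" "y = l" | "x \<noteq> l" "y \<noteq> l" by blast
  then show "crossing (t, s') x y = slide l z (crossing (t, s)) x y"
  proof cases
    case 3
    then show ?thesis
      using l[of x] sympD[OF sym] sympD[OF symp_crossing[of "(t, s')"]] by blast
  qed (use l in \<open>auto simp: slide_def crossing_def s'_def\<close>)
qed

lemma crossing_lz: "crossing (t, s) l z"
  using z_neq_l t_z s_l t_less[of l] s_less[of z] by (auto simp: crossing_def)

end

lemma crossing_rauzy_move:
  fixes p :: "'a::finite pair"
  assumes "CARD('a) \<ge> 2" "is_pair p" "irreducible_pair p"
  obtains l z where "l \<noteq> z" "crossing p l z"
    "crossing (rauzy_move False p) = slide l z (crossing p)"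
proof -
  obtain z l where "rauzy_setup (fst p) (snd p) z l"
    using rauzy_setup_obtain[OF assms] .
  then interpret rauzy_setup "fst p" "snd p" z l .
  show ?thesis
    using that[of l z] z_neq_l crossing_lz crossing_move
    by (simp add: rauzy_move_def rauzy_row_eq)
qed

lemma crossing_class_invariant:
  fixes p q :: "'a::finite pair" and F :: "('a \<Rightarrow> 'a \<Rightarrow> bool) \<Rightarrow> 'b"
  assumes "CARD('a) \<ge> 2" "is_pair p" "irreducible_pair p" "q \<in> ext_rauzy_class p"
    and slide: "\<And>c l z. symp c \<Longrightarrow> irreflp c \<Longrightarrow> l \<noteq> z \<Longrightarrow> c l z \<Longrightarrow> F (slide l z c) = F c"
  shows "F (crossing q) = F (crossing p)"
proof (rule ext_rauzy_class_invariant(1)[OF assms(1-4)])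
  fix p :: "'a pair" assume "is_pair p" "irreducible_pair p"
  then show "F (crossing (rauzy_move False p)) = F (crossing p)"
    using crossing_rauzy_move[OF assms(1)] slide[OF symp_crossing irreflp_crossing] by metis
qed (simp_all add: crossing_swap crossing_reflect)

section \<open>Representation by edges of a graph\<close>

text \<open>With parity, sharing one end becomes the scalar product modulo 2 of characteristic
  vectors, which is additive under symmetric differences. Parallel edges are allowed, and they do
  not cross.\<close>

definition edge_rep :: "('a \<Rightarrow> 'a \<Rightarrow> bool) \<Rightarrow> ('a \<Rightarrow> nat set) \<Rightarrow> bool" where
  "edge_rep c \<phi> \<longleftrightarrow> (\<forall>a. card (\<phi> a) = 2) \<and> (\<forall>a b. a \<noteq> b \<longrightarrow> (c a b \<longleftrightarrow> odd (card (\<phi> a \<inter> \<phi> b))))"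

lemma card_sym_diff:
  assumes "finite A" "finite B"
  shows "card ((A - B) \<union> (B - A)) + 2 * card (A \<inter> B) = card A + card B"
proof -
  have "card A = card (A - B) + card (A \<inter> B)" "card B = card (B - A) + card (A \<inter> B)"
    using assms by (simp_all add: card_Int_Diff[of A B] card_Int_Diff[of B A] Int_commute)
  moreover have "card ((A - B) \<union> (B - A)) = card (A - B) + card (B - A)"
    using assms by (intro card_Un_disjoint) auto
  ultimately show ?thesis by simp
qed

lemma edge_rep_slide:
  fixes c :: "'a \<Rightarrow> 'a \<Rightarrow> bool"
  assumes "edge_rep c \<phi>" "symp c" "l \<noteq> z" "c l z"
  shows "\<exists>\<phi>'. edge_rep (slide l z c) \<phi>'"
proof -
  define D where "D = (\<phi> l - \<phi> z) \<union> (\<phi> z - \<phi> l)"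
  have card2: "card (\<phi> a) = 2" and rep: "a \<noteq> b \<Longrightarrow> c a b \<longleftrightarrow> odd (card (\<phi> a \<inter> \<phi> b))" for a b
    using assms(1) by (auto simp: edge_rep_def)
  have fin: "finite (\<phi> a)" for a
    using card2[of a] by (metis card.infinite zero_neq_numeral)
  have "card (\<phi> l \<inter> \<phi> z) \<le> 2"
    using card2[of l] card_mono[OF fin[of l], of "\<phi> l \<inter> \<phi> z"] by simp
  moreover have "odd (card (\<phi> l \<inter> \<phi> z))"
    using rep[OF assms(3)] assms(4) by simp
  ultimately have "card (\<phi> l \<inter> \<phi> z) = 1"
    by presburger
  then have D2: "card D = 2"
    using card_sym_diff[OF fin fin, of l z] card2 unfolding D_def by simp
  \<comment> \<open>The parity of the intersection with a fixed set is additive under symmetric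
    difference.\<close>
  have par: "odd (card (D \<inter> \<phi> y)) \<longleftrightarrow> odd (card (\<phi> l \<inter> \<phi> y)) \<noteq> odd (card (\<phi> z \<inter> \<phi> y))" for y
  proof -
    have "D \<inter> \<phi> y = (\<phi> l \<inter> \<phi> y - \<phi> z \<inter> \<phi> y) \<union> (\<phi> z \<inter> \<phi> y - \<phi> l \<inter> \<phi> y)"
      by (auto simp: D_def)
    then have "card (D \<inter> \<phi> y) + 2 * card (\<phi> l \<inter> \<phi> y \<inter> (\<phi> z \<inter> \<phi> y))
        = card (\<phi> l \<inter> \<phi> y) + card (\<phi> z \<inter> \<phi> y)"
      using card_sym_diff[of "\<phi> l \<inter> \<phi> y" "\<phi> z \<inter> \<phi> y"] fin by simp
    then show ?thesis by presburger
  qed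
  have D: "odd (card (D \<inter> \<phi> y)) \<longleftrightarrow> slide l z c l y" if "y \<noteq> l" for y
  proof (cases "y = z")
    case True
    then show ?thesis
      using par[of z] rep[of l z] assms card2 by (simp add: slide_def)
  next
    case False
    then show ?thesis
      using par[of y] rep[of l y] rep[of z y] that by (auto simp: slide_def)
  qed
  have "edge_rep (slide l z c) (\<phi>(l := D))"
    unfolding edge_rep_def
  proof (intro conjI allI impI)
    fix a b :: 'a assume "a \<noteq> b"
    then consider "a = l" "b \<noteq> l" | "a \<noteq> l" "b = l" | "a \<noteq> l" "b \<noteq> l" by blast
    then show "slide l z c a b = odd (card ((\<phi>(l := D)) a \<inter> (\<phi>(l := D)) b))"
    proof cases
      case 2
      then show ?thesis
        using D[of a] sympD[OF symp_slide[OF assms(2)]] by (auto simp: Int_commute)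
    qed (use D rep \<open>a \<noteq> b\<close> in \<open>auto simp: slide_def\<close>)
  qed (use card2 D2 in simp)
  then show ?thesis by blast
qed

lemma ex_edge_rep_slide:
  assumes "symp c" "l \<noteq> z" "c l z"
  shows "(\<exists>\<phi>. edge_rep (slide l z c) \<phi>) \<longleftrightarrow> (\<exists>\<phi>. edge_rep c \<phi>)"
proof
  assume "\<exists>\<phi>. edge_rep (slide l z c) \<phi>"
  then obtain \<phi> where "edge_rep (slide l z c) \<phi>" by blast
  moreover have "slide l z c l z" using assms by (simp add: slide_def)
  ultimately show "\<exists>\<phi>. edge_rep c \<phi>"
    using edge_rep_slide[of "slide l z c" \<phi> l z] symp_slide slide_slide assms by metis
next
  assume "\<exists>\<phi>. edge_rep c \<phi>"
  then show "\<exists>\<phi>. edge_rep (slide l z c) \<phi>"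
    using edge_rep_slide[OF _ assms] by blast
qed

text \<open>Let \<open>a\<close> and \<open>b\<close> be the edges \<open>{u, \<alpha>}\<close> and
  \<open>{u, \<beta>}\<close>. An edge that crosses both is \<open>{\<alpha>, \<beta>}\<close> or
  \<open>{u, \<gamma>}\<close> with a new \<gamma>. The former crosses no edge of these two kinds,
  so all four letters are edges at \<open>u\<close>. As \<open>c1\<close> and \<open>c2\<close> do
  not cross \<open>d1\<close>, both are parallel to it, and parallel edges do not cross.\<close>

lemma two_stars_no_edge_rep:
  assumes "edge_rep c \<phi>" and "symp c"
    and "a \<noteq> b" "c a b" "c1 \<noteq> c2" "c c1 c2" "d1 \<noteq> d2" "c d1 d2"
    and hub: "\<And>x. x \<in> {c1, c2, d1, d2} \<Longrightarrow> x \<noteq> a \<and> x \<noteq> b \<and> c a x \<and> c b x"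
    and apart: "\<And>x y. x \<in> {c1, c2} \<Longrightarrow> y \<in> {d1, d2} \<Longrightarrow> x \<noteq> y \<and> \<not> c x y"
  shows False
proof -
  have card2: "card (\<phi> a) = 2" and rep: "a \<noteq> b \<Longrightarrow> c a b \<longleftrightarrow> odd (card (\<phi> a \<inter> \<phi> b))" for a b
    using assms(1) by (auto simp: edge_rep_def)
  have pair: "\<exists>x y. \<phi> v = {x, y} \<and> x \<noteq> y" for v
    using card2[of v] by (auto simp: card_2_iff)
  have "odd (card (\<phi> a \<inter> \<phi> b))" using rep assms(3,4) by blast
  then have ne: "\<phi> a \<inter> \<phi> b \<noteq> {}" and neq: "\<phi> a \<noteq> \<phi> b"
    using card2[of a] by auto
  from ne obtain u where u: "u \<in> \<phi> a" "u \<in> \<phi> b" by blast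
  have other: "\<exists>w. \<phi> v = {u, w} \<and> u \<noteq> w" if "u \<in> \<phi> v" for v
    using pair[of v] that by (auto simp: doubleton_eq_iff)
  obtain \<alpha> where \<alpha>: "\<phi> a = {u, \<alpha>}" "u \<noteq> \<alpha>" using other[OF u(1)] by blast
  obtain \<beta> where \<beta>: "\<phi> b = {u, \<beta>}" "u \<noteq> \<beta>" using other[OF u(2)] by blast
  have "\<alpha> \<noteq> \<beta>" using \<alpha> \<beta> neq by blast
  have dich: "\<phi> x = {\<alpha>, \<beta>} \<or> (\<exists>\<gamma>. \<phi> x = {u, \<gamma>} \<and> \<gamma> \<notin> {u, \<alpha>, \<beta>})" if "x \<in> {c1, c2, d1, d2}" for x
  proof -
    have odd: "odd (card ({u, \<alpha>} \<inter> \<phi> x))" "odd (card ({u, \<beta>} \<inter> \<phi> x))"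
      using hub[OF that] rep[of a x] rep[of b x] \<alpha> \<beta> by auto
    show ?thesis
    proof (cases "u \<in> \<phi> x")
      case True
      then obtain \<gamma> where "\<phi> x = {u, \<gamma>}" "u \<noteq> \<gamma>" using other by blast
      moreover have "\<gamma> \<noteq> \<alpha>" "\<gamma> \<noteq> \<beta>"
        using odd \<alpha>(2) \<beta>(2) calculation by auto
      ultimately show ?thesis by blast
    next
      case False
      then have "\<alpha> \<in> \<phi> x" "\<beta> \<in> \<phi> x"
        using odd by (auto simp: Int_insert_left split: if_splits)
      moreover obtain y w where "\<phi> x = {y, w}" using pair by blast
      ultimately show ?thesis using \<open>\<alpha> \<noteq> \<beta>\<close> by auto
    qed
  qed
  have star: "\<exists>\<gamma>. \<phi> x = {u, \<gamma>} \<and> \<gamma> \<notin> {u, \<alpha>, \<beta>}"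
    if "x \<in> {c1, c2, d1, d2}" "y \<in> {c1, c2, d1, d2}" "x \<noteq> y" "c x y" for x y
  proof (rule ccontr)
    assume "\<not> ?thesis"
    then have "\<phi> x = {\<alpha>, \<beta>}" using dich[OF that(1)] by blast
    moreover have "odd (card (\<phi> x \<inter> \<phi> y))" using rep that by blast
    ultimately show False
      using dich[OF that(2)] \<alpha> \<beta> \<open>\<alpha> \<noteq> \<beta>\<close> by (auto simp: Int_insert_left)
  qed
  obtain \<gamma>1 \<gamma>2 \<delta>1 \<delta>2 where *: "\<phi> c1 = {u, \<gamma>1}" "\<phi> c2 = {u, \<gamma>2}" "\<phi> d1 = {u, \<delta>1}" "\<phi> d2 = {u, \<delta>2}"
    "u \<noteq> \<gamma>1" "u \<noteq> \<gamma>2" "u \<noteq> \<delta>1" "u \<noteq> \<delta>2"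
    using star[of c1 c2] star[of c2 c1] star[of d1 d2] star[of d2 d1] assms(5-8) sympD[OF \<open>symp c\<close>]
    by blast
  have "even (card (\<phi> c1 \<inter> \<phi> d1))" "even (card (\<phi> c2 \<inter> \<phi> d1))"
    using apart rep by blast+
  then have "\<gamma>1 = \<delta>1" "\<gamma>2 = \<delta>1" using * by (auto simp: Int_insert_left split: if_splits)
  then have "even (card (\<phi> c1 \<inter> \<phi> c2))" using * card2[of c1] by simp
  then show False using rep assms(5,6) by blast
qed

section \<open>The Gauss sum\<close>

definition edges :: "('a \<Rightarrow> 'a \<Rightarrow> bool) \<Rightarrow> 'a set \<Rightarrow> 'a set set" where
  "edges c X = {{x, y} |x y. x \<in> X \<and> y \<in> X \<and> c x y}"

definition sgn_of :: "bool \<Rightarrow> int" where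
  "sgn_of P = (if P then -1 else 1)"

definition edge_sgn :: "('a \<Rightarrow> 'a \<Rightarrow> bool) \<Rightarrow> 'a set \<Rightarrow> int" where
  "edge_sgn c X = (-1) ^ card (edges c X)"

lemma prod_sgn_of: "finite X \<Longrightarrow> (\<Prod>x\<in>X. sgn_of (P x)) = (-1) ^ card {x \<in> X. P x}"
proof -
  assume "finite X"
  then have "(\<Prod>x\<in>X. sgn_of (P x)) = (\<Prod>x | x \<in> X \<and> P x. -1)"
    unfolding sgn_of_def by (intro prod.mono_neutral_cong_right) auto
  then show ?thesis by simp
qed

lemma sgn_of_neq: "sgn_of (P \<noteq> Q) = sgn_of P * sgn_of Q"
  by (simp add: sgn_of_def)

lemma edge_sgn_insert:
  assumes "finite X" "x \<notin> X" "symp c" "irreflp c"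
  shows "edge_sgn c (insert x X) = edge_sgn c X * (\<Prod>y\<in>X. sgn_of (c x y))"
proof -
  let ?N = "{y \<in> X. c x y}"
  have "edges c (insert x X) = edges c X \<union> (\<lambda>y. {x, y}) ` ?N"
    using assms(3,4) by (auto simp: edges_def image_iff irreflp_def dest: sympD)
  moreover have "edges c X \<inter> (\<lambda>y. {x, y}) ` ?N = {}"
    using assms(2) by (auto simp: edges_def doubleton_eq_iff)
  moreover have "finite (edges c X)"
    by (rule finite_subset[of _ "Pow X"]) (use assms(1) in \<open>auto simp: edges_def\<close>)
  moreover have "inj_on (\<lambda>y. {x, y}) ?N"
    using assms(2) by (auto intro!: inj_onI simp: doubleton_eq_iff)
  ultimately have "card (edges c (insert x X)) = card (edges c X) + card ?N"
    using assms(1) by (simp add: card_Un_disjoint card_image)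
  then show ?thesis
    using assms(1) by (simp add: edge_sgn_def prod_sgn_of power_add)
qed

lemma edge_sgn_cong:
  assumes "\<And>x y. x \<in> X \<Longrightarrow> y \<in> X \<Longrightarrow> c x y = c' x y"
  shows "edge_sgn c X = edge_sgn c' X"
proof -
  have "edges c X = edges c' X" using assms by (auto simp: edges_def)
  then show ?thesis by (simp add: edge_sgn_def)
qed

lemma edge_sgn_empty [simp]: "edge_sgn c {} = 1"
  by (simp add: edge_sgn_def edges_def)

text \<open>This is (-1)^q at the sum of the basis vectors in \<open>X\<close>: the quadratic form q
  with value 1 on every letter and polar form c takes there the value |X| plus the number of
  crossing pairs in \<open>X\<close>, modulo 2.\<close>

definition subset_sgn :: "('a \<Rightarrow> 'a \<Rightarrow> bool) \<Rightarrow> 'a set \<Rightarrow> int" where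
  "subset_sgn c X = (-1) ^ card X * edge_sgn c X"

definition gauss_sum :: "('a \<Rightarrow> 'a \<Rightarrow> bool) \<Rightarrow> int" where
  "gauss_sum c = (\<Sum>X\<in>UNIV. subset_sgn c X)"

text \<open>In the new basis \<open>insert l Y\<close> denotes the old vector that also contains
  e_z. The sign of the additional letter cancels that of the crossing of \<open>l\<close> and
  \<open>z\<close>; equivalently, q(e_l + e_z) = 1 + 1 + 1 = 1.\<close>

lemma subset_sgn_slide:
  fixes c :: "'a::finite \<Rightarrow> 'a \<Rightarrow> bool"
  assumes "symp c" "irreflp c" "l \<noteq> z" "c l z" "l \<notin> Y" "z \<notin> Y"
  shows "subset_sgn (slide l z c) (insert l Y) = subset_sgn c (insert z (insert l Y))"
proof -
  have "edge_sgn (slide l z c) (insert l Y)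
      = edge_sgn (slide l z c) Y * (\<Prod>y\<in>Y. sgn_of (slide l z c l y))"
    using assms by (intro edge_sgn_insert symp_slide irreflp_slide) auto
  also have "edge_sgn (slide l z c) Y = edge_sgn c Y"
    using assms by (intro edge_sgn_cong) (auto simp: slide_def)
  also have "(\<Prod>y\<in>Y. sgn_of (slide l z c l y)) = (\<Prod>y\<in>Y. sgn_of (c l y) * sgn_of (c z y))"
  proof (intro prod.cong refl)
    fix y assume "y \<in> Y"
    then have "slide l z c l y \<longleftrightarrow> c l y \<noteq> c z y"
      using assms by (auto simp: slide_def)
    then show "sgn_of (slide l z c l y) = sgn_of (c l y) * sgn_of (c z y)"
      by (simp only: sgn_of_neq)
  qed
  finally have 1: "edge_sgn (slide l z c) (insert l Y)
      = edge_sgn c Y * (\<Prod>y\<in>Y. sgn_of (c l y)) * (\<Prod>y\<in>Y. sgn_of (c z y))"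
    by (simp add: prod.distrib)
  have "c z l" using assms by (auto dest: sympD)
  then have "edge_sgn c (insert z (insert l Y))
      = - (edge_sgn c Y * (\<Prod>y\<in>Y. sgn_of (c l y)) * (\<Prod>y\<in>Y. sgn_of (c z y)))"
    using assms by (simp add: edge_sgn_insert sgn_of_def)
  with 1 show ?thesis
    using assms by (simp add: subset_sgn_def)
qed

lemma subset_sgn_slide_notin:
  assumes "l \<notin> X"
  shows "subset_sgn (slide l z c) X = subset_sgn c X"
proof -
  have "edge_sgn (slide l z c) X = edge_sgn c X"
    using assms by (intro edge_sgn_cong) (auto simp: slide_def)
  then show ?thesis by (simp add: subset_sgn_def)
qed

lemma gauss_sum_slide:
  fixes c :: "'a::finite \<Rightarrow> 'a \<Rightarrow> bool"
  assumes "symp c" "irreflp c" "l \<noteq> z" "c l z"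
  shows "gauss_sum (slide l z c) = gauss_sum c"
proof -
  \<comment> \<open>\<open>h X\<close> is the set that gives the same vector in the old basis: e_l
    brings e_z along, so \<open>z\<close> is toggled whenever \<open>l\<close> is present.\<close>
  define h where "h X = (if l \<notin> X then X else if z \<in> X then X - {z} else insert z X)" for X
  have hh: "h (h X) = X" for X
    using assms(3) by (auto simp: h_def)
  have "subset_sgn (slide l z c) X = subset_sgn c (h X)" for X
  proof -
    consider "l \<notin> X" | "l \<in> X" "z \<notin> X" | "l \<in> X" "z \<in> X" by blast
    then show ?thesis
    proof cases
      case 1
      then show ?thesis by (simp add: h_def subset_sgn_slide_notin)
    next
      case 2
      then show ?thesis
        using subset_sgn_slide[OF assms, of "X - {l}"] by (simp add: h_def insert_absorb)
    next
      case 3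
      \<comment> \<open>Removing \<open>z\<close> is the inverse of adding it, so the identity is
        applied to the slid relation, whose slide is \<open>c\<close> again.\<close>
      let ?c = "slide l z c"
      have "subset_sgn (slide l z ?c) (insert l (X - {l, z}))
          = subset_sgn ?c (insert z (insert l (X - {l, z})))"
        using assms by (intro subset_sgn_slide symp_slide irreflp_slide) (auto simp: slide_def)
      moreover have "insert z (insert l (X - {l, z})) = X" "insert l (X - {l, z}) = X - {z}"
        using 3 assms(3) by auto
      ultimately show ?thesis
        using 3 assms(1,3) by (simp add: h_def slide_slide)
    qed
  qed
  then have "gauss_sum (slide l z c) = (\<Sum>X\<in>UNIV. subset_sgn c (h X))"
    by (simp add: gauss_sum_def)
  also have "\<dots> = gauss_sum c"
    unfolding gauss_sum_def by (rule sum.reindex_bij_witness[of _ h h]) (auto simp: hh)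
  finally show ?thesis .
qed

section \<open>Angles of singularities\<close>

text \<open>
  Colours \<open>f\<close> of left and \<open>g\<close> of right end points of the intervals, constant on the
  singularities of the suspended surface.
\<close>

definition vertex_colouring :: "'a::finite pair \<Rightarrow> ('a \<Rightarrow> nat) \<Rightarrow> ('a \<Rightarrow> nat) \<Rightarrow> bool" where
  "vertex_colouring p f g \<longleftrightarrow>
     (\<forall>r\<in>{fst p, snd p}. \<forall>a b. r b = Suc (r a) \<longrightarrow> g a = f b) \<and>
     (\<forall>a b. fst p a = 1 \<longrightarrow> snd p b = 1 \<longrightarrow> f a = f b) \<and>
     (\<forall>a b. fst p a = CARD('a) \<longrightarrow> snd p b = CARD('a) \<longrightarrow> g a = g b)"

text \<open>A singularity of angle \<open>2 \<pi> d\<close> contains \<open>d\<close> left end points other than that of the first interval.\<close>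

definition small_vertices :: "'a::finite pair \<Rightarrow> bool" where
  "small_vertices p \<longleftrightarrow>
     (\<exists>f g. vertex_colouring p f g \<and> (\<forall>k. card {a. fst p a \<noteq> 1 \<and> f a = k} \<le> 3))"

lemma vertex_colouringD:
  fixes p :: "'a::finite pair"
  assumes "vertex_colouring p f g"
  shows "fst p b = Suc (fst p a) \<Longrightarrow> g a = f b" "snd p b = Suc (snd p a) \<Longrightarrow> g a = f b"
    "fst p a = 1 \<Longrightarrow> snd p b = 1 \<Longrightarrow> f a = f b"
    "fst p a = CARD('a) \<Longrightarrow> snd p b = CARD('a) \<Longrightarrow> g a = g b"
  using assms by (auto simp: vertex_colouring_def)

lemma vertex_colouring_swap:
  "vertex_colouring (swap_rows p) f g \<longleftrightarrow> vertex_colouring p f g"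
proof -
  have "vertex_colouring (swap_rows p) f g" if "vertex_colouring p f g" for p :: "'a::finite pair"
  proof -
    note D = vertex_colouringD[OF that]
    show ?thesis
      unfolding vertex_colouring_def swap_rows_def fst_conv snd_conv
      by (intro conjI ballI allI impI) (auto intro: D(1) D(2) D(3)[symmetric] D(4)[symmetric])
  qed
  from this[of p] this[of "swap_rows p"] show ?thesis by auto
qed

text \<open>The count leaves out the first letter of the top row. The first letter of the bottom row
  has the same colour, so leaving it out instead gives the same counts.\<close>

lemma small_vertices_swap:
  fixes p :: "'a::finite pair"
  assumes "is_pair p"
  shows "small_vertices (swap_rows p) \<longleftrightarrow> small_vertices p"
proof -
  have eq: "card {a. fst p a \<noteq> 1 \<and> f a = k} = card {a. snd p a \<noteq> 1 \<and> f a = k}"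
    if col: "vertex_colouring p f g" for f g k
  proof -
    have bij: "bij_betw (fst p) UNIV {1..CARD('a)}" "bij_betw (snd p) UNIV {1..CARD('a)}"
      using assms(1) by (simp_all add: is_pair_def)
    have "1 \<le> CARD('a)" by (simp add: Suc_leI)
    then obtain a b where ab: "fst p a = 1" "snd p b = 1"
      using row_surj[OF bij(1)] row_surj[OF bij(2)] by (metis order_refl)
    have "fst p x = 1 \<longleftrightarrow> x = a" "snd p x = 1 \<longleftrightarrow> x = b" for x
      using row_eq_iff[OF bij(1)] row_eq_iff[OF bij(2)] ab by metis+
    then have "{x. fst p x \<noteq> 1 \<and> f x = k} = {x. f x = k} - {a}"
      "{x. snd p x \<noteq> 1 \<and> f x = k} = {x. f x = k} - {b}" by auto
    moreover have "f a = f b" using vertex_colouringD(3)[OF col ab] .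
    ultimately show ?thesis
      by (cases "f a = k") (simp_all add: card_Diff_singleton)
  qed
  then show ?thesis
    unfolding small_vertices_def vertex_colouring_swap
    by (simp only: swap_rows_def fst_conv eq cong: conj_cong)
qed

text \<open>Reversal exchanges left and right end points, hence \<open>f\<close> and
  \<open>g\<close>. Passing to the next letter of the top row maps the right ends other than the
  last injectively to the left ends other than the first and keeps the colour.\<close>

lemma small_vertices_reflect_imp:
  fixes p :: "'a::finite pair"
  assumes "is_pair p" "small_vertices p"
  shows "small_vertices (reflect_rows p)"
proof -
  let ?n = "CARD('a)"
  have bij: "bij_betw (fst p) UNIV {1..?n}" "bij_betw (snd p) UNIV {1..?n}"
    using assms(1) by (simp_all add: is_pair_def)
  obtain f g where col: "vertex_colouring p f g"
    and small: "\<And>k. card {a. fst p a \<noteq> 1 \<and> f a = k} \<le> 3"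
    using assms(2) by (auto simp: small_vertices_def)
  have fl: "?n + 1 - r b = Suc (?n + 1 - r a) \<longleftrightarrow> r a = Suc (r b)"
    "?n + 1 - r a = 1 \<longleftrightarrow> r a = ?n" "?n + 1 - r a = ?n \<longleftrightarrow> r a = 1"
    if "bij_betw r UNIV {1..?n}" for r :: "'a \<Rightarrow> nat" and a b
    using row_range[OF that, of a] row_range[OF that, of b] by linarith+
  have "vertex_colouring (reflect_rows p) g f"
    unfolding vertex_colouring_def reflect_rows_def fst_conv snd_conv
    using vertex_colouringD[OF col] fl[OF bij(1)] fl[OF bij(2)] by auto
  moreover have "card {a. fst (reflect_rows p) a \<noteq> 1 \<and> g a = k} \<le> 3" for k
  proof -
    define succ where "succ a = letter_at (fst p) (fst p a + 1)" for a
    have succ: "fst p (succ a) = fst p a + 1" if "fst p a \<noteq> ?n" for a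
    proof -
      have "1 \<le> fst p a + 1" "fst p a + 1 \<le> ?n"
        using that row_range[OF bij(1), of a] by linarith+
      then show ?thesis
        using letter_at_eq_iff[OF bij(1)] unfolding succ_def by blast
    qed
    have "inj_on succ {a. fst p a \<noteq> ?n \<and> g a = k}"
    proof (rule inj_onI)
      fix x y assume "x \<in> {a. fst p a \<noteq> ?n \<and> g a = k}" "y \<in> {a. fst p a \<noteq> ?n \<and> g a = k}"
        "succ x = succ y"
      then have "fst p x = fst p y" using succ[of x] succ[of y] by simp
      then show "x = y" using row_eq_iff[OF bij(1)] by simp
    qed
    moreover have "succ ` {a. fst p a \<noteq> ?n \<and> g a = k} \<subseteq> {a. fst p a \<noteq> 1 \<and> f a = k}"
    proof (rule image_subsetI)
      fix a assume "a \<in> {a. fst p a \<noteq> ?n \<and> g a = k}"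
      then have a: "fst p a \<noteq> ?n" "g a = k" by simp_all
      have "f (succ a) = g a"
        using vertex_colouringD(1)[OF col, of "succ a" a] succ[OF a(1)] by simp
      moreover have "fst p (succ a) \<noteq> 1"
        using succ[OF a(1)] row_range[OF bij(1), of a] by simp
      ultimately show "succ a \<in> {a. fst p a \<noteq> 1 \<and> f a = k}"
        using a(2) by simp
    qed
    ultimately have "card {a. fst p a \<noteq> ?n \<and> g a = k} \<le> card {a. fst p a \<noteq> 1 \<and> f a = k}"
      by (rule card_inj_on_le) simp
    moreover have "fst (reflect_rows p) a \<noteq> 1 \<longleftrightarrow> fst p a \<noteq> ?n" for a
      using fl(2)[OF bij(1)] by (simp add: reflect_rows_def)
    ultimately show ?thesis using small[of k] by simp
  qed
  ultimately show ?thesis by (auto simp: small_vertices_def)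
qed

lemma small_vertices_reflect:
  fixes p :: "'a::finite pair"
  assumes "is_pair p"
  shows "small_vertices (reflect_rows p) \<longleftrightarrow> small_vertices p"
  using small_vertices_reflect_imp is_pair_reflect reflect_reflect assms by metis

context rauzy_setup
begin

lemma s'_simps:
  "s' l = s z + 1" "s' b = 1 \<longleftrightarrow> s b = 1"
  "s' b = CARD('a) \<longleftrightarrow> (if s z + 1 = CARD('a) then b = l else s b + 1 = CARD('a))"
proof -
  show "s' l = s z + 1" by (simp add: s'_def)
  show "s' b = 1 \<longleftrightarrow> s b = 1"
    using s_range[of z] s_range[of b] s_l s_z_less by (auto simp: s'_def)
  show "s' b = CARD('a) \<longleftrightarrow> (if s z + 1 = CARD('a) then b = l else s b + 1 = CARD('a))"
    using s_z_less s_less[of b] s_l by (auto simp: s'_def)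
qed

lemma s'_succ:
  "s' b = Suc (s' a) \<longleftrightarrow>
     (if a = z then b = l else if b = l then False
      else if a = l then s b = Suc (s z) else s b = Suc (s a))"
  using s_less[of a] s_less[of b] s_z_less s_l z_neq_l s_eq_iff[of a z] s_eq_iff[of b z]
  by (auto simp: s'_def)

text \<open>Only the right end of \<open>z\<close> is glued differently: before the move it agrees
  with the right end of \<open>l\<close>, since both letters are last; afterwards it agrees with the
  left end of \<open>l\<close>, which now follows \<open>z\<close>. By \<open>g z = g l\<close> the
  letter \<open>l\<close> can take over the old successor of \<open>z\<close>. The old predecessor
  of \<open>l\<close> becomes last, and its right end has the colour \<open>f l\<close>, as
  required.\<close>

lemma vertex_colouring_move:
  assumes "vertex_colouring (t, s) f g"
  shows "vertex_colouring (t, s') f (g(z := f l))"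
proof -
  note D = vertex_colouringD[OF assms, unfolded fst_conv snd_conv]
  have lz: "g z = g l" using D(4)[of z l] t_z s_l by simp
  show ?thesis
    unfolding vertex_colouring_def fst_conv snd_conv
  proof (intro conjI allI impI ballI)
    fix r a b assume r: "r \<in> {t, s'}" and rb: "r b = Suc (r a)"
    show "(g(z := f l)) a = f b"
    proof (cases "r = t")
      case True
      then have "a \<noteq> z" using rb t_z t_range[of b] by auto
      then show ?thesis using True rb D(1) by simp
    next
      case False
      then have "s' b = Suc (s' a)" using r rb by simp
      then show ?thesis using D(2)[of b a] D(2)[of b z] lz
        by (auto simp: s'_succ split: if_splits)
    qed
  next
    fix a b assume "t a = 1" "s' b = 1"
    then show "f a = f b" using D(3) unfolding s'_simps by blast
  next
    fix a b assume a: "t a = CARD('a)" and b: "s' b = CARD('a)"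
    have "a = z" using a t_z t_eq_iff[of a z] by simp
    moreover have "(g(z := f l)) b = f l"
    proof (cases "s z + 1 = CARD('a)")
      case True
      then show ?thesis using b lz D(2)[of l z] s_l z_neq_l by (simp add: s'_simps)
    next
      case False
      then show ?thesis using b D(2)[of l b] s_l by (simp add: s'_simps)
    qed
    ultimately show "(g(z := f l)) a = (g(z := f l)) b" by simp
  qed
qed

lemma vertex_colouring_move_back:
  assumes "vertex_colouring (t, s') f g"
  shows "vertex_colouring (t, s) f (g(z := g l))"
proof -
  note D = vertex_colouringD[OF assms, unfolded fst_conv snd_conv]
  have zl: "g z = f l" using D(2)[of l z] by (simp add: s'_succ)
  show ?thesis
    unfolding vertex_colouring_def fst_conv snd_conv
  proof (intro conjI allI impI ballI)
    fix r a b assume r: "r \<in> {t, s}" and rb: "r b = Suc (r a)"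
    show "(g(z := g l)) a = f b"
    proof (cases "r = t")
      case True
      then have "a \<noteq> z" using rb t_z t_range[of b] by auto
      then show ?thesis using True rb D(1) by simp
    next
      case False
      then have sb: "s b = Suc (s a)" using r rb by simp
      then have "a \<noteq> l" using s_l s_range[of b] by auto
      show ?thesis
      proof (cases "b = l")
        case False
        \<comment> \<open>In the new row \<open>b\<close> is still preceded by \<open>a\<close>,
          unless \<open>a\<close> is \<open>z\<close>: then \<open>l\<close> has been inserted
          between them.\<close>
        then show ?thesis
          using sb D(2)[of b "if a = z then l else a"] \<open>a \<noteq> l\<close> z_neq_l by (auto simp: s'_succ split: if_splits)
      next
        case True
        then have "s a + 1 = CARD('a)" using sb s_l by simp
        \<comment> \<open>The predecessor of \<open>l\<close> becomes the last letter, except that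
          \<open>l\<close> stays last if it already followed \<open>z\<close>.\<close>
        then have "s' (if a = z then l else a) = CARD('a)"
          using s_eq_iff[of a z] by (auto simp only: s'_simps split: if_splits)
        then have "g z = g (if a = z then l else a)" using D(4) t_z by blast
        then show ?thesis using zl True by (auto split: if_splits)
      qed
    qed
  next
    fix a b assume "t a = 1" "s b = 1"
    then show "f a = f b" using D(3) unfolding s'_simps by blast
  next
    fix a b assume a: "t a = CARD('a)" and b: "s b = CARD('a)"
    have "a = z" using a t_z t_eq_iff[of a z] by simp
    moreover have "b = l" using b s_l s_eq_iff[of b l] by simp
    ultimately show "(g(z := g l)) a = (g(z := g l)) b" by simp
  qed
qed

text \<open>Both conversions of colourings keep \<open>f\<close>, and the top row is the same, so
  the counts do not change.\<close>

lemma small_vertices_move: "small_vertices (t, s') \<longleftrightarrow> small_vertices (t, s)"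
  unfolding small_vertices_def fst_conv
  using vertex_colouring_move vertex_colouring_move_back by blast

end

lemma small_vertices_class_invariant:
  fixes p q :: "'a::finite pair"
  assumes "CARD('a) \<ge> 2" "is_pair p" "irreducible_pair p" "q \<in> ext_rauzy_class p"
  shows "small_vertices q \<longleftrightarrow> small_vertices p"
proof (rule ext_rauzy_class_invariant(1)[OF assms])
  fix p :: "'a pair" assume "is_pair p" "irreducible_pair p"
  then obtain z l where "rauzy_setup (fst p) (snd p) z l"
    using rauzy_setup_obtain[OF assms(1)] by blast
  then interpret rauzy_setup "fst p" "snd p" z l .
  show "small_vertices (rauzy_move False p) = small_vertices p"
    using small_vertices_move by (simp add: rauzy_move_def rauzy_row_eq)
qed (simp_all add: small_vertices_swap small_vertices_reflect)

section \<open>Gauss sums of disjoint unions and cliques\<close>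

text \<open>This is the Gauss sum of the quadratic form with value 0, not 1, on every letter. It is
  what remains of \<open>gauss_sum\<close> when two letters that cross everything are summed
  out.\<close>

definition plain_sum :: "('a \<Rightarrow> 'a \<Rightarrow> bool) \<Rightarrow> 'a set \<Rightarrow> int" where
  "plain_sum c V = (\<Sum>X\<in>Pow V. edge_sgn c X)"

lemma sum_Pow_insert:
  fixes f :: "'a set \<Rightarrow> int"
  assumes "finite V" "v \<notin> V"
  shows "(\<Sum>X\<in>Pow (insert v V). f X) = (\<Sum>X\<in>Pow V. f X + f (insert v X))"
proof -
  have "inj_on (insert v) (Pow V)"
    using assms(2) by (auto intro!: inj_onI)
  moreover have "Pow V \<inter> insert v ` Pow V = {}" using assms(2) by auto
  ultimately show ?thesis
    using assms by (simp add: Pow_insert sum.union_disjoint sum.reindex sum.distrib)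
qed

lemma edge_sgn_Un:
  assumes "symp c" "irreflp c" "finite X" "finite Y" "X \<inter> Y = {}"
    and "\<And>x y. x \<in> X \<Longrightarrow> y \<in> Y \<Longrightarrow> \<not> c x y"
  shows "edge_sgn c (X \<union> Y) = edge_sgn c X * edge_sgn c Y"
  using assms(4-6)
proof (induction Y rule: finite_induct)
  case (insert y Y)
  have "(\<Prod>x\<in>X \<union> Y. sgn_of (c y x)) = (\<Prod>x\<in>X. sgn_of (c y x)) * (\<Prod>x\<in>Y. sgn_of (c y x))"
    using insert assms(3) by (intro prod.union_disjoint) auto
  also have "(\<Prod>x\<in>X. sgn_of (c y x)) = 1"
    using insert.prems(2) sympD[OF assms(1)] by (intro prod.neutral) (auto simp: sgn_of_def)
  finally show ?case
    using insert assms(1-3) by (simp add: edge_sgn_insert)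
qed simp

lemma plain_sum_Un:
  assumes "symp c" "irreflp c" "finite V" "finite W" "V \<inter> W = {}"
    and "\<And>x y. x \<in> V \<Longrightarrow> y \<in> W \<Longrightarrow> \<not> c x y"
  shows "plain_sum c (V \<union> W) = plain_sum c V * plain_sum c W"
proof -
  have "plain_sum c V * plain_sum c W = (\<Sum>(X, Y)\<in>Pow V \<times> Pow W. edge_sgn c X * edge_sgn c Y)"
    unfolding plain_sum_def by (simp add: sum_product sum.cartesian_product)
  also have "\<dots> = (\<Sum>(X, Y)\<in>Pow V \<times> Pow W. edge_sgn c (X \<union> Y))"
  proof (intro sum.cong refl, clarify)
    fix X Y assume "X \<subseteq> V" "Y \<subseteq> W"
    then have "finite X" "finite Y" "X \<inter> Y = {}"
      using assms(3-5) by (auto dest: finite_subset)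
    moreover have "\<not> c x y" if "x \<in> X" "y \<in> Y" for x y
      using that assms(6) \<open>X \<subseteq> V\<close> \<open>Y \<subseteq> W\<close> by blast
    ultimately show "edge_sgn c X * edge_sgn c Y = edge_sgn c (X \<union> Y)"
      using edge_sgn_Un[OF assms(1,2)] by simp
  qed
  also have "\<dots> = plain_sum c (V \<union> W)"
    unfolding plain_sum_def
    by (rule sum.reindex_bij_witness[of _ "\<lambda>Z. (Z \<inter> V, Z \<inter> W)" "\<lambda>(X, Y). X \<union> Y"])
      (use assms(5) in auto)
  finally show ?thesis ..
qed

text \<open>Pascal's rule in recursive form: the value is the sum of binomial(k, j) * f j over j, in
  a shape that \<open>simp\<close> can evaluate.\<close>

fun binomial_sum :: "(nat \<Rightarrow> int) \<Rightarrow> nat \<Rightarrow> int" where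
  "binomial_sum f 0 = f 0"
| "binomial_sum f (Suc k) = binomial_sum f k + binomial_sum (\<lambda>j. f (Suc j)) k"

lemma sum_Pow_card:
  assumes "finite V"
  shows "(\<Sum>X\<in>Pow V. f (card X)) = binomial_sum f (card V)"
  using assms
proof (induction V arbitrary: f rule: finite_induct)
  case (insert v V)
  have "(\<Sum>X\<in>Pow (insert v V). f (card X)) = (\<Sum>X\<in>Pow V. f (card X) + f (card (insert v X)))"
    using insert by (intro sum_Pow_insert)
  also have "\<dots> = (\<Sum>X\<in>Pow V. f (card X) + f (Suc (card X)))"
  proof (intro sum.cong refl)
    fix X assume "X \<in> Pow V"
    then have "finite X" "v \<notin> X" using insert by (auto dest: finite_subset)
    then show "f (card X) + f (card (insert v X)) = f (card X) + f (Suc (card X))" by simp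
  qed
  finally show ?case using insert by (simp add: sum.distrib)
qed simp

text \<open>The exponent is the number j(j - 1)/2 of pairs among j letters. The value is the real
  part plus the imaginary part of (1 + i)^k, which explains the zero at k = 3 and the negative signs
  at 4 and 5.\<close>

definition clique_sum :: "nat \<Rightarrow> int" where
  "clique_sum k = binomial_sum (\<lambda>j. (-1) ^ (\<Sum>i<j. i)) k"

lemma edge_sgn_clique:
  assumes "symp c" "irreflp c" "finite X" "\<And>x y. x \<in> X \<Longrightarrow> y \<in> X \<Longrightarrow> x \<noteq> y \<Longrightarrow> c x y"
  shows "edge_sgn c X = (-1) ^ (\<Sum>i<card X. i)"
  using assms(3,4)
proof (induction X rule: finite_induct)
  case (insert x X)
  have "(\<Prod>y\<in>X. sgn_of (c x y)) = (\<Prod>y\<in>X. -1)"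
    using insert by (intro prod.cong) (auto simp: sgn_of_def)
  then show ?case
    using insert assms(1,2) by (simp add: edge_sgn_insert power_add)
qed simp

lemma plain_sum_clique:
  assumes "symp c" "irreflp c" "finite V" "\<And>x y. x \<in> V \<Longrightarrow> y \<in> V \<Longrightarrow> x \<noteq> y \<Longrightarrow> c x y"
  shows "plain_sum c V = clique_sum (card V)"
proof -
  have "plain_sum c V = (\<Sum>X\<in>Pow V. (-1) ^ (\<Sum>i<card X. i))"
    unfolding plain_sum_def using assms
    by (intro sum.cong refl edge_sgn_clique) (auto dest: finite_subset)
  then show ?thesis
    using sum_Pow_card[OF assms(3), of "\<lambda>j. (-1) ^ (\<Sum>i<j. i)"] by (simp add: clique_sum_def)
qed

lemma clique_sum_values:
  "clique_sum 1 = 2" "clique_sum 2 = 2" "clique_sum 3 = 0" "clique_sum 4 = -4" "clique_sum 5 = -8"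
  by (simp_all add: clique_sum_def numeral_eq_Suc)

text \<open>Fix a set X without \<open>a\<close> and \<open>b\<close>. The terms of X and of X with
  both letters cancel. With exactly one of them, its |X| crossings cancel the sign (-1)^|X|, and the
  letter itself gives a factor -1; this happens twice.\<close>

lemma gauss_sum_hubs:
  fixes c :: "'a::finite \<Rightarrow> 'a \<Rightarrow> bool"
  assumes "symp c" "irreflp c" "a \<noteq> b" "c a b" "\<And>x. x \<notin> {a, b} \<Longrightarrow> c a x \<and> c b x"
  shows "gauss_sum c = -2 * plain_sum c (- {a, b})"
proof -
  let ?V = "- {a, b}"
  have "gauss_sum c = (\<Sum>X\<in>Pow (insert b (insert a ?V)). subset_sgn c X)"
    unfolding gauss_sum_def by (rule sum.cong) auto
  also have "\<dots> = (\<Sum>X\<in>Pow ?V. subset_sgn c X + subset_sgn c (insert b X)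
      + (subset_sgn c (insert a X) + subset_sgn c (insert b (insert a X))))"
    using assms(3) by (subst sum_Pow_insert, simp, simp)+ (rule refl)
  also have "\<dots> = (\<Sum>X\<in>Pow ?V. -2 * edge_sgn c X)"
  proof (intro sum.cong refl)
    fix X assume "X \<in> Pow ?V"
    then have X: "a \<notin> X" "b \<notin> X" by auto
    have "(\<Prod>y\<in>X. sgn_of (c v y)) = (-1) ^ card X" if "v \<in> {a, b}" for v
    proof -
      have "c v y" if "y \<in> X" for y
      proof -
        have "y \<notin> {a, b}" using that X by blast
        then show ?thesis using assms(5) \<open>v \<in> {a, b}\<close> by blast
      qed
      then have "(\<Prod>y\<in>X. sgn_of (c v y)) = (\<Prod>y\<in>X. -1)"
        by (intro prod.cong) (simp_all add: sgn_of_def)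
      then show ?thesis by simp
    qed
    moreover have "c b a" using assms(1,4) by (auto dest: sympD)
    ultimately show "subset_sgn c X + subset_sgn c (insert b X)
      + (subset_sgn c (insert a X) + subset_sgn c (insert b (insert a X))) = -2 * edge_sgn c X"
      using X assms by (cases "even (card X)") (simp_all add: subset_sgn_def edge_sgn_insert sgn_of_def)
  qed
  finally show ?thesis by (simp add: plain_sum_def sum_distrib_left)
qed

section \<open>Chains of blocks\<close>

lemma chains_neq_Nil [simp]: "chains s \<noteq> []"
  by (induction s) (auto split: list.split)

lemma chains_cases:
  obtains c cs where "chains s = c # cs"
  using chains_neq_Nil[of s] by (cases "chains s") auto

lemma concat_chains: "concat (chains s) = filter (\<lambda>k. k \<noteq> 1) s"
proof (induction s)
  case (Cons x s)
  then show ?case by (cases rule: chains_cases[of s]) auto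
qed simp

lemma concat_nonempty_chains: "concat (nonempty_chains s) = filter (\<lambda>k. k \<noteq> 1) s"
proof -
  have "concat (filter (\<lambda>c. c \<noteq> []) cs) = concat cs" for cs :: "nat list list"
    by (induction cs) auto
  then show ?thesis by (simp add: nonempty_chains_def concat_chains)
qed

text \<open>Blocks of size 1 have the positive factor 2, so the sign depends on the chains
  only.\<close>

lemma sgn_prod_list_chains:
  "sgn (prod_list (map clique_sum s)) = prod_list (map (\<lambda>c. sgn (prod_list (map clique_sum c))) (chains s))"
proof (induction s)
  case (Cons x s)
  then show ?case
    by (cases rule: chains_cases[of s]) (auto simp: clique_sum_values(1)[simplified] sgn_mult)
qed simp

lemma sgn_prod_list_filter_chains:
  assumes "\<And>c. c \<in> set (chains s) \<Longrightarrow> sgn (prod_list (map clique_sum c)) = (if P c then -1 else 1)"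
  shows "sgn (prod_list (map clique_sum s)) = (-1) ^ length (filter P (chains s))"
proof -
  have "prod_list (map (\<lambda>c. sgn (prod_list (map clique_sum c))) cs) = (-1) ^ length (filter P cs)"
    if "set cs \<subseteq> set (chains s)" for cs
    using that assms by (induction cs) auto
  then show ?thesis by (subst sgn_prod_list_chains) blast
qed

lemma hd_chains_eq_Nil_iff: "hd (chains s) = [] \<longleftrightarrow> s = [] \<or> hd s = 1"
  by (cases s; cases rule: chains_cases[of "tl s"]) auto

text \<open>The restriction to the tail makes this inductive: a new block in front lengthens the
  first chain, or, if it is a 1-block, moves that chain into the tail, where it then starts just
  after this block.\<close>

lemma tl_chains_start:
  assumes "x # c \<in> set (tl (chains s))"
  shows "\<exists>i < length s. s ! i = x \<and> 0 < i \<and> s ! (i - 1) = 1"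
  using assms
proof (induction s)
  case (Cons y s)
  obtain d ds where ch: "chains s = d # ds" by (rule chains_cases)
  have ?case if "x # c \<in> set (tl (chains s))"
  proof -
    from Cons.IH[OF that] obtain i where "i < length s" "s ! i = x" "0 < i" "s ! (i - 1) = 1"
      by (elim exE conjE)
    then show ?thesis
      by (intro exI[of _ "Suc i"]) (auto simp: nth_Cons')
  qed
  moreover have ?case if "y = 1" "x # c = d"
  proof -
    have "hd (chains s) = x # c" using ch that by simp
    then have "s \<noteq> [] \<and> s ! 0 = x"
      by (cases s; cases rule: chains_cases[of "tl s"]) (auto split: if_splits)
    then show ?thesis
      using that by (intro exI[of _ 1]) auto
  qed
  ultimately show ?case
    using Cons.prems ch by (auto split: if_splits)
qed simp

lemma chains_start:
  assumes "x # c \<in> set (chains s)"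
  shows "\<exists>i < length s. s ! i = x \<and> (i = 0 \<or> s ! (i - 1) = 1)"
proof (cases "x # c \<in> set (tl (chains s))")
  case True
  then show ?thesis using tl_chains_start by blast
next
  case False
  then have "hd (chains s) = x # c"
    using assms by (cases rule: chains_cases[of s]) auto
  then have "s \<noteq> [] \<and> s ! 0 = x"
    by (cases s; cases rule: chains_cases[of "tl s"]) (auto split: if_splits)
  then show ?thesis by auto
qed

lemma prod_list_clique_twos: "all_twos c \<Longrightarrow> sgn (prod_list (map clique_sum c)) = 1"
  by (induction c) (auto simp: all_twos_def clique_sum_values sgn_mult)

lemma sgn_clique_type2:
  assumes "type_sizes 2 s"
  shows "sgn (prod_list (map clique_sum s)) = 1"
proof -
  have "sgn (prod_list (map clique_sum c)) = 1" if "c \<in> set (chains s)" for c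
    using assms that prod_list_clique_twos[of c]
    by (cases "c = []") (auto simp: type_sizes_def nonempty_chains_def)
  then show ?thesis
    using sgn_prod_list_filter_chains[of s "\<lambda>_. False"] by simp
qed

lemma sgn_clique_type3:
  assumes "type_sizes 3 s"
  shows "prod_list (map clique_sum s) = 0"
proof -
  obtain c where c: "c \<in> set (chains s)" "chain3_i c"
    using assms by (auto simp: type_sizes_def nonempty_chains_def)
  then have "3 \<in> set c" by (auto simp: chain3_i_def)
  then have "3 \<in> set (concat (chains s))" using c by auto
  then have "3 \<in> set s" unfolding concat_chains by simp
  then show ?thesis
    using clique_sum_values(3) by (force simp: prod_list_zero_iff)
qed

text \<open>Exactly one chain has a negative product, since all others contain only 2-blocks or
  nothing.\<close>

lemma sgn_clique_type45:
  assumes "type_sizes x s" "x = 4 \<or> x = 5"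
  shows "sgn (prod_list (map clique_sum s)) = -1"
proof -
  define P where "P = (if x = 4 then chain4 else (\<lambda>c. c = [5]))"
  have one: "length (filter P (chains s)) = 1"
    using assms by (auto simp: type_sizes_def P_def)
  have "sgn (prod_list (map clique_sum c)) = (if P c then -1 else 1)" if c: "c \<in> set (chains s)" for c
  proof (cases "P c")
    case True
    then show ?thesis
      using assms(2) prod_list_clique_twos
      by (auto simp: P_def chain4_def all_twos_def clique_sum_values sgn_mult split: if_splits)
  next
    case False
    then have "c = [] \<or> all_twos c"
      using assms c by (auto simp: type_sizes_def nonempty_chains_def P_def all_twos_def)
    then show ?thesis using False prod_list_clique_twos[of c] by auto
  qed
  then show ?thesis
    using sgn_prod_list_filter_chains[of s P] one by simp
qed

section \<open>Gap colours for Type 5\<close>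

text \<open>
  Colours of the gaps between consecutive letters after the current gap, which has colour \<open>c\<close>. The
  gaps of a chain belong to one singularity, except that the 5-block carries two alternating ones.
\<close>

fun gap_colours :: "nat \<Rightarrow> nat list \<Rightarrow> nat list" where
  "gap_colours c [] = []"
| "gap_colours c (x # s) =
     (if x = 2 then [c, c] @ gap_colours c s
      else if x = 5 then [c + 1, c, c + 1, c, c + 1] @ gap_colours (c + 1) s
      else (c + 1) # gap_colours (c + 1) s)"

lemma type5_chains_Cons:
  assumes "set (chains (x # s)) \<subseteq> {[], [2], [5]}"
  shows "set (chains s) \<subseteq> {[], [2], [5]}" "x \<in> {1, 2, 5}" "x \<noteq> 1 \<Longrightarrow> s = [] \<or> hd s = 1"
proof -
  obtain c cs where ch: "chains s = c # cs" by (rule chains_cases)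
  have *: "x = 1 \<or> c = [] \<and> x \<in> {2, 5}"
    using assms ch by auto
  then show "set (chains s) \<subseteq> {[], [2], [5]}" "x \<in> {1, 2, 5}"
    using assms ch by (auto split: if_splits)
  show "s = [] \<or> hd s = 1" if "x \<noteq> 1"
    using * that ch hd_chains_eq_Nil_iff[of s] by simp
qed

lemma gap_colours_ge: "y \<in> set (gap_colours c s) \<Longrightarrow> c \<le> y"
proof (induction s arbitrary: c)
  case (Cons x s)
  from Cons.prems show ?case
    using Cons.IH[of c] Cons.IH[of "c + 1"] by (auto split: if_splits)
qed simp

text \<open>The last two bounds carry the induction. The current gap is not in the list, so its
  colour may recur only twice, and it must not recur at all once a 1-block or the end
  follows.\<close>

lemma gap_colours_count:
  assumes "set (chains s) \<subseteq> {[], [2], [5]}"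
  shows "count_list (gap_colours c s) y \<le> 3" "count_list (gap_colours c s) c \<le> 2"
    "s = [] \<or> hd s = 1 \<Longrightarrow> count_list (gap_colours c s) c = 0"
proof -
  have "(\<forall>y. count_list (gap_colours c s) y \<le> 3) \<and> count_list (gap_colours c s) c \<le> 2 \<and>
    (s = [] \<or> hd s = 1 \<longrightarrow> count_list (gap_colours c s) c = 0)"
    using assms
  proof (induction s arbitrary: c)
    case (Cons x s)
    note step = type5_chains_Cons[OF Cons.prems]
    have fresh: "count_list (gap_colours (Suc c) s) c = 0"
      using gap_colours_ge[of c "Suc c" s] by (auto simp: count_list_0_iff)
    consider "x = 1" | "x = 2" "s = [] \<or> hd s = 1" | "x = 5" "s = [] \<or> hd s = 1"
      using step(2,3) by auto
    then show ?case
    proof cases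
      case 1
      then show ?thesis
        using Cons.IH[OF step(1), of "Suc c"] fresh by (auto simp: le_Suc_eq)
    next
      case 2
      then show ?thesis
        using Cons.IH[OF step(1), of c] by auto
    next
      case 3
      then show ?thesis
        using Cons.IH[OF step(1), of "Suc c"] fresh by auto
    qed
  qed simp
  then show "count_list (gap_colours c s) y \<le> 3" "count_list (gap_colours c s) c \<le> 2"
    "s = [] \<or> hd s = 1 \<Longrightarrow> count_list (gap_colours c s) c = 0" by auto
qed

lemma length_gap_colours:
  assumes "set (chains s) \<subseteq> {[], [2], [5]}"
  shows "length (gap_colours c s) = sum_list s"
  using assms
proof (induction s arbitrary: c)
  case (Cons x s)
  then show ?case using type5_chains_Cons[OF Cons.prems] by auto
qed simp

text \<open>A letter at offset m of its block in one row has offset \<open>s ! i - 1 - m\<close> in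
  the other. The two statements compare its left gaps and its right gaps in the two rows. In a block
  of size k they link gap j with k - 1 - j and with k + 1 - j, hence gaps two apart: this gives two
  alternating classes for k = 5 and a single class for k = 2.\<close>

lemma gap_colours_symmetric:
  assumes "set (chains s) \<subseteq> {[], [2], [5]}" "i < length s"
  defines "o\<^sub>i \<equiv> sum_list (take i s)"
  shows "m < s ! i \<Longrightarrow> (c # gap_colours c s) ! (o\<^sub>i + m) = (c # gap_colours c s) ! (o\<^sub>i + (s ! i - 1 - m))"
    and "1 \<le> m \<Longrightarrow> m \<le> s ! i \<Longrightarrow>
      (c # gap_colours c s) ! (o\<^sub>i + m) = (c # gap_colours c s) ! (o\<^sub>i + (s ! i + 1 - m))"
proof -
  have "(m < s ! i \<longrightarrow> (c # gap_colours c s) ! (o\<^sub>i + m) = (c # gap_colours c s) ! (o\<^sub>i + (s ! i - 1 - m)))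
    \<and> (1 \<le> m \<and> m \<le> s ! i \<longrightarrow>
      (c # gap_colours c s) ! (o\<^sub>i + m) = (c # gap_colours c s) ! (o\<^sub>i + (s ! i + 1 - m)))"
    using assms(1,2) unfolding o\<^sub>i_def
  proof (induction s arbitrary: c i)
    case (Cons x s)
    note step = type5_chains_Cons[OF Cons.prems(1)]
    show ?case
    proof (cases i)
      case 0
      then consider "x = 1" | "x = 2" | "x = 5" using step(2) by auto
      then show ?thesis
      proof cases
        case 1
        then show ?thesis using 0 by (cases m) auto
      next
        case 2
        have "m = 0 \<or> m = 1 \<or> m = 2 \<or> 2 < m" by arith
        then show ?thesis using 0 2 by (auto simp: numeral_2_eq_2)
      next
        case 3
        have "m = 0 \<or> m = 1 \<or> m = 2 \<or> m = 3 \<or> m = 4 \<or> m = 5 \<or> 5 < m" by arith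
        then show ?thesis using 0 3 by (auto simp: numeral_eq_Suc)
      qed
    next
      case (Suc j)
      \<comment> \<open>The last gap of the first block is the current gap for the remaining blocks,
        so their list starts with its colour.\<close>
      have *: "(c # gap_colours c (x # s)) ! (x + k)
        = (let c' = (if x = 2 then c else c + 1) in (c' # gap_colours c' s) ! k)" for k
        using step(2) by (auto simp: numeral_eq_Suc Let_def)
      have "j < length s" using Cons.prems(2) Suc by simp
      from Cons.IH[OF step(1) this, of "if x = 2 then c else c + 1"] show ?thesis
        unfolding Suc by (simp only: take_Suc_Cons sum_list.Cons add.assoc * Let_def nth_Cons_Suc length_Cons Suc_less_eq)
    qed
  qed simp
  then show "m < s ! i \<Longrightarrow> (c # gap_colours c s) ! (o\<^sub>i + m) = (c # gap_colours c s) ! (o\<^sub>i + (s ! i - 1 - m))"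
    "1 \<le> m \<Longrightarrow> m \<le> s ! i \<Longrightarrow>
      (c # gap_colours c s) ! (o\<^sub>i + m) = (c # gap_colours c s) ! (o\<^sub>i + (s ! i + 1 - m))"
    by blast+
qed

lemma type5_chains:
  assumes "type_sizes 5 s"
  shows "set (chains s) \<subseteq> {[], [2], [5]}"
  using assms by (auto simp: type_sizes_def nonempty_chains_def)

lemma type4_chain_start:
  assumes "type_sizes 4 s"
  shows "\<exists>i < length s. s ! i = 4 \<and> (i = 0 \<or> s ! (i - 1) = 1)"
proof -
  have "filter chain4 (chains s) \<noteq> []"
    using assms by (auto simp: type_sizes_def)
  then obtain c where "c \<in> set (chains s)" "chain4 c"
    by (auto simp: filter_empty_conv)
  then show ?thesis using chains_start by (auto simp: chain4_def)
qed

lemma type1_big_unique: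
  assumes "type_sizes 1 s"
  shows "length (filter (\<lambda>k. k \<noteq> 1) s) \<le> 1"
proof -
  have "length (nonempty_chains s) \<le> 1" "\<forall>c\<in>set (nonempty_chains s). length c = 1"
    using assms by (auto simp: type_sizes_def)
  then have "length (concat (nonempty_chains s)) \<le> 1"
    by (cases "nonempty_chains s") auto
  then show ?thesis by (simp add: concat_nonempty_chains)
qed

lemma type_sizes_cases:
  assumes "type_sizes x s"
  obtains "x = 1" | "x \<in> {2, 3, 4, 5}" "many_big_blocks s"
  using assms by (auto simp: type_sizes_def)

section \<open>Piece-wise order reversing pairs\<close>

locale por_pair =
  fixes p :: "'a::finite pair" and ks :: "nat list"
  assumes card_ge2: "CARD('a) \<ge> 2" and is_pair: "is_pair p"
    and standard: "standard_pair p" and decomp: "por_decomp p ks"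
begin

abbreviation "t \<equiv> fst p"
abbreviation "s \<equiv> snd p"
abbreviation "sz \<equiv> block_sizes ks"

definition block :: "nat \<Rightarrow> 'a set" where
  "block i = {x. ks ! i \<le> t x \<and> t x < ks ! Suc i}"

lemma bij_t: "bij_betw t UNIV {1..CARD('a)}" and bij_s: "bij_betw s UNIV {1..CARD('a)}"
  using is_pair by (simp_all add: is_pair_def)

lemmas t_range = row_range[OF bij_t] and s_range = row_range[OF bij_s]
  and t_eq_iff = row_eq_iff[OF bij_t] and s_eq_iff = row_eq_iff[OF bij_s]

definition a where "a = letter_at t 1"
definition b where "b = letter_at s 1"

lemma t_a: "t a = 1" and s_a: "s a = CARD('a)" and s_b: "s b = 1" and t_b: "t b = CARD('a)"
proof -
  have *: "letter_at r k = x \<Longrightarrow> r x = k" if "bij_betw r UNIV {1..CARD('a)}" "k \<in> {1, CARD('a)}"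
    for r :: "'a \<Rightarrow> nat" and k x
    using letter_at_eq_iff[OF that(1), of k x] that(2) card_ge2 by auto
  show "t a = 1" "s a = CARD('a)" "s b = 1" "t b = CARD('a)"
    using *[OF bij_t] *[OF bij_s] standard by (simp_all add: a_def b_def standard_pair_def)
qed

lemma a_neq_b: "a \<noteq> b"
  using t_a t_b card_ge2 by auto

lemma length_ks: "length ks = Suc (length sz)"
  using decomp by (cases ks) (simp_all add: por_decomp_def block_sizes_def)

lemma ks_0: "ks ! 0 = 2"
  using decomp unfolding por_decomp_def by (metis hd_conv_nth)

lemma ks_last: "ks ! length sz = CARD('a)"
  using decomp length_ks unfolding por_decomp_def by (metis last_conv_nth diff_Suc_1)

lemma ks_less: "i < j \<Longrightarrow> j \<le> length sz \<Longrightarrow> ks ! i < ks ! j"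
  using decomp length_ks by (simp add: por_decomp_def sorted_wrt_iff_nth_less)

lemma ks_le: "i \<le> j \<Longrightarrow> j \<le> length sz \<Longrightarrow> ks ! i \<le> ks ! j"
  using ks_less[of i j] by (cases "i = j") auto

lemma sz_nth: "i < length sz \<Longrightarrow> sz ! i = ks ! Suc i - ks ! i"
  by (simp add: block_sizes_def)

lemma ks_Suc: "i < length sz \<Longrightarrow> ks ! Suc i = ks ! i + sz ! i"
  using sz_nth[of i] ks_less[of i "Suc i"] by simp

lemma ks_eq_sum: "i \<le> length sz \<Longrightarrow> ks ! i = 2 + sum_list (take i sz)"
  by (induction i) (simp_all add: ks_0 ks_Suc take_Suc_conv_app_nth)

lemma ks_bounds: "i \<le> length sz \<Longrightarrow> 2 \<le> ks ! i" "i \<le> length sz \<Longrightarrow> ks ! i \<le> CARD('a)"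
  using ks_le[of 0 i] ks_le[of i "length sz"] ks_0 ks_last by auto

lemma
  assumes "i < length sz" "x \<in> block i"
  shows block_s: "ks ! i \<le> s x" "s x < ks ! Suc i"
    and block_sum: "t x + s x + 1 = ks ! i + ks ! Suc i"
proof -
  have *: "\<forall>i. 1 \<le> i \<and> i < length ks \<longrightarrow>
        {b. ks!(i-1) \<le> t b \<and> t b < ks!i} = {b. ks!(i-1) \<le> s b \<and> s b < ks!i} \<and>
        (\<forall>b. ks!(i-1) \<le> t b \<and> t b < ks!i \<longrightarrow> t b + s b = ks!(i-1) + ks!i - 1)"
    using decomp unfolding por_decomp_def by blast
  have "1 \<le> Suc i \<and> Suc i < length ks" using assms(1) length_ks by simp
  from *[rule_format, OF this]
  have eq: "block i = {b. ks ! i \<le> s b \<and> s b < ks ! Suc i}"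
    and sum: "\<And>b. b \<in> block i \<Longrightarrow> t b + s b = ks ! i + ks ! Suc i - 1"
    by (auto simp: block_def)
  show "ks ! i \<le> s x" "s x < ks ! Suc i" using assms(2) eq by auto
  then show "t x + s x + 1 = ks ! i + ks ! Suc i" using sum[OF assms(2)] by simp
qed

lemma in_block_below:
  assumes "j \<le> length sz" "2 \<le> t x" "t x < ks ! j"
  shows "\<exists>i<j. x \<in> block i"
  using assms
proof (induction j)
  case (Suc j)
  show ?case
  proof (cases "t x < ks ! j")
    case True
    then show ?thesis using Suc by (auto intro: less_SucI)
  next
    case False
    then show ?thesis using Suc.prems by (auto simp: block_def intro!: exI[of _ j])
  qed
qed (simp add: ks_0)

lemma inner_block:
  assumes "x \<noteq> a" "x \<noteq> b"
  obtains i where "i < length sz" "x \<in> block i"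
proof -
  have "2 \<le> t x" "t x < CARD('a)"
    using t_range[of x] t_eq_iff[of x a] t_eq_iff[of x b] t_a t_b assms by linarith+
  then show ?thesis using in_block_below[of "length sz" x] ks_last that by auto
qed

lemma block_inner:
  assumes "i < length sz" "x \<in> block i"
  shows "x \<noteq> a" "x \<noteq> b"
proof -
  have "2 \<le> t x" "t x < CARD('a)"
    using assms ks_bounds[of i] ks_bounds[of "Suc i"] by (auto simp: block_def)
  then show "x \<noteq> a" "x \<noteq> b" using t_a t_b by auto
qed

lemma crossing_same_block:
  assumes "i < length sz" "x \<in> block i" "y \<in> block i" "x \<noteq> y"
  shows "crossing p x y"
proof -
  have "t x < t y \<or> t y < t x" using assms(4) t_eq_iff[of x y] by linarith
  then show ?thesis
    using block_sum[OF assms(1,2)] block_sum[OF assms(1,3)] by (auto simp: crossing_def)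
qed

lemma not_crossing_blocks:
  assumes "i < j" "j < length sz" "x \<in> block i" "y \<in> block j"
  shows "\<not> crossing p x y" "x \<noteq> y"
proof -
  have "ks ! Suc i \<le> ks ! j" using assms by (intro ks_le) auto
  moreover have "i < length sz" using assms by simp
  ultimately have "t x < t y" "s x < s y"
    using block_s[of i x] block_s[of j y] assms by (auto simp: block_def)
  then show "\<not> crossing p x y" "x \<noteq> y" by (auto simp: crossing_def)
qed

lemma crossing_iff_block:
  assumes "i < length sz" "j < length sz" "x \<in> block i" "y \<in> block j" "x \<noteq> y"
  shows "crossing p x y \<longleftrightarrow> i = j"
  using crossing_same_block[of i x y] not_crossing_blocks[of i j x y] not_crossing_blocks[of j i y x]
    sympD[OF symp_crossing[of p]] assms
  by (metis linorder_neqE_nat)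

lemma crossing_a: "x \<noteq> a \<Longrightarrow> crossing p a x"
  using t_range[of x] s_range[of x] t_eq_iff[of x a] s_eq_iff[of x a] t_a s_a
  by (simp add: crossing_def)

lemma crossing_b: "x \<noteq> b \<Longrightarrow> crossing p b x"
  using t_range[of x] s_range[of x] t_eq_iff[of x b] s_eq_iff[of x b] t_b s_b
  by (simp add: crossing_def)

lemma card_block:
  assumes "i < length sz"
  shows "card (block i) = sz ! i"
proof -
  have "t ` block i = {ks ! i..<ks ! Suc i}"
  proof
    show "{ks ! i..<ks ! Suc i} \<subseteq> t ` block i"
    proof
      fix k assume k: "k \<in> {ks ! i..<ks ! Suc i}"
      then have "1 \<le> k" "k \<le> CARD('a)"
        using ks_bounds(1)[of i] ks_bounds(2)[of "Suc i"] assms by auto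
      then obtain x where "t x = k" by (rule row_surj[OF bij_t])
      then show "k \<in> t ` block i" using k by (auto simp: block_def)
    qed
  qed (auto simp: block_def)
  moreover have "inj_on t (block i)" using t_eq_iff by (auto intro: inj_onI)
  ultimately show ?thesis
    using card_image[of t "block i"] sz_nth[OF assms] by simp
qed

text \<open>A further block crosses nothing in the earlier ones, so the sum is multiplied; inside a
  block the order reversal makes any two letters cross.\<close>

lemma plain_sum_prefix:
  "j \<le> length sz \<Longrightarrow>
    plain_sum (crossing p) {x. 2 \<le> t x \<and> t x < ks ! j} = prod_list (map clique_sum (take j sz))"
proof (induction j)
  case 0
  have empty: "{x. 2 \<le> t x \<and> t x < ks ! 0} = {}" using ks_0 by auto
  show ?case unfolding empty by (simp add: plain_sum_def)
next
  case (Suc j)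
  let ?V = "{x. 2 \<le> t x \<and> t x < ks ! j}"
  have j: "j < length sz" using Suc.prems by simp
  have "{x. 2 \<le> t x \<and> t x < ks ! Suc j} = ?V \<union> block j"
    using ks_bounds(1)[of j] ks_less[of j "Suc j"] j by (auto simp: block_def)
  moreover have "plain_sum (crossing p) (?V \<union> block j)
      = plain_sum (crossing p) ?V * plain_sum (crossing p) (block j)"
  proof (rule plain_sum_Un[OF symp_crossing irreflp_crossing])
    show "?V \<inter> block j = {}" by (auto simp: block_def)
    fix x y assume x: "x \<in> ?V" and y: "y \<in> block j"
    obtain i where "i < j" "x \<in> block i"
      using in_block_below[of j x] x j by auto
    then show "\<not> crossing p x y" using not_crossing_blocks[of i j x y] j y by simp
  qed simp_all
  moreover have "plain_sum (crossing p) (block j) = clique_sum (sz ! j)"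
    using plain_sum_clique[OF symp_crossing irreflp_crossing _ crossing_same_block[OF j]] card_block[OF j]
    by simp
  ultimately show ?case
    using Suc.IH j by (simp add: take_Suc_conv_app_nth)
qed

lemma gauss_sum_eq: "gauss_sum (crossing p) = -2 * prod_list (map clique_sum sz)"
proof -
  have "- {a, b} = {x. 2 \<le> t x \<and> t x < ks ! length sz}"
  proof -
    have "x \<noteq> a \<and> x \<noteq> b \<longleftrightarrow> 2 \<le> t x \<and> t x < CARD('a)" for x
      using t_range[of x] t_eq_iff[of x a] t_eq_iff[of x b] t_a t_b by auto
    then show ?thesis unfolding ks_last by blast
  qed
  moreover have "gauss_sum (crossing p) = -2 * plain_sum (crossing p) (- {a, b})"
    using a_neq_b crossing_a crossing_b by (intro gauss_sum_hubs symp_crossing irreflp_crossing) auto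
  ultimately show ?thesis using plain_sum_prefix[of "length sz"] by simp
qed

lemma many_big_blocks_no_edge_rep:
  assumes "many_big_blocks sz"
  shows "\<not> edge_rep (crossing p) \<phi>"
proof
  assume rep: "edge_rep (crossing p) \<phi>"
  define I where "I = {i. i < length sz \<and> 2 \<le> sz ! i}"
  have "finite I" by (simp add: I_def)
  moreover have "\<not> card I \<le> Suc 0"
    using assms by (simp add: many_big_blocks_def length_filter_conv_card I_def)
  ultimately have "\<exists>i\<in>I. \<exists>j\<in>I. i \<noteq> j"
    using card_le_Suc0_iff_eq by blast
  then obtain i j where ij: "i \<in> I" "j \<in> I" "i < j"
    unfolding nat_neq_iff by blast
  have two: "\<exists>x y. x \<in> block k \<and> y \<in> block k \<and> x \<noteq> y" if "k \<in> I" for k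
  proof -
    have "\<not> card (block k) \<le> Suc 0" using that card_block by (auto simp: I_def)
    then show ?thesis using card_le_Suc0_iff_eq[of "block k"] by auto
  qed
  obtain c1 c2 where c: "c1 \<in> block i" "c2 \<in> block i" "c1 \<noteq> c2" using two[OF ij(1)] by blast
  obtain d1 d2 where d: "d1 \<in> block j" "d2 \<in> block j" "d1 \<noteq> d2" using two[OF ij(2)] by blast
  have len: "i < length sz" "j < length sz" using ij by (auto simp: I_def)
  show False
  proof (rule two_stars_no_edge_rep[OF rep symp_crossing])
    show "a \<noteq> b" "crossing p a b" using a_neq_b crossing_a by auto
    show "c1 \<noteq> c2" "crossing p c1 c2" "d1 \<noteq> d2" "crossing p d1 d2"
      using c d len crossing_same_block by auto
    show "x \<noteq> a \<and> x \<noteq> b \<and> crossing p a x \<and> crossing p b x" if "x \<in> {c1, c2, d1, d2}" for x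
      using that c d len block_inner crossing_a crossing_b by blast
    show "x \<noteq> y \<and> \<not> crossing p x y" if "x \<in> {c1, c2}" "y \<in> {d1, d2}" for x y
      using that c d len ij(3) not_crossing_blocks[of i j x y] by blast
  qed
qed

text \<open>The letters \<open>a\<close> and \<open>b\<close> become edges 01 and 02. Letters of
  1-blocks become parallel edges 12, which cross only \<open>a\<close> and \<open>b\<close>. Letters
  of the only larger block become edges from 0 to private vertices; these cross one another as well
  as \<open>a\<close> and \<open>b\<close>.\<close>

lemma type1_edge_rep:
  assumes "type_sizes 1 sz"
  shows "\<exists>\<phi>. edge_rep (crossing p) \<phi>"
proof -
  \<comment> \<open>This expresses membership in a block of size at least 2 through the crossing
    relation alone.\<close>
  define big where "big x \<longleftrightarrow> (\<exists>y. y \<noteq> x \<and> y \<noteq> a \<and> y \<noteq> b \<and> crossing p x y)" for x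
  define \<phi> :: "'a \<Rightarrow> nat set" where
    "\<phi> x = (if x = a then {0, 1} else if x = b then {0, 2}
      else if big x then {0, t x + 3} else {1, 2})" for x
  let ?I = "{i. i < length sz \<and> sz ! i \<noteq> 1}"
  have "card ?I \<le> Suc 0"
    using type1_big_unique[OF assms] by (simp add: length_filter_conv_card)
  then have unique: "i = j" if "i \<in> ?I" "j \<in> ?I" for i j
    using that by (subst (asm) card_le_Suc0_iff_eq) auto
  have big_block: "i \<in> ?I" if big: "big x" "i < length sz" "x \<in> block i" "x \<noteq> a" "x \<noteq> b" for x i
  proof -
    obtain y where y: "y \<noteq> x" "y \<noteq> a" "y \<noteq> b" "crossing p x y" using big unfolding big_def by blast
    obtain j where j: "j < length sz" "y \<in> block j" using inner_block[OF y(2,3)] by blast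
    have "y \<in> block i" using crossing_iff_block[of i j x y] that j y by auto
    then have "card (block i) \<noteq> Suc 0"
      using y(1) that(3) by (auto simp: card_1_singleton_iff)
    then show ?thesis using that(2) card_block by simp
  qed
  have cross: "crossing p x y \<longleftrightarrow> big x \<and> big y"
    if xy: "x \<noteq> y" "x \<noteq> a" "x \<noteq> b" "y \<noteq> a" "y \<noteq> b" for x y
  proof
    assume "crossing p x y"
    then show "big x \<and> big y" using xy sympD[OF symp_crossing[of p], of x y] unfolding big_def by metis
  next
    assume "big x \<and> big y"
    moreover obtain i where i: "i < length sz" "x \<in> block i" using inner_block xy by blast
    moreover obtain j where j: "j < length sz" "y \<in> block j" using inner_block xy by blast
    ultimately have "i = j" using unique[of i j] big_block[of x i] big_block[of y j] xy by simp
    then show "crossing p x y" using crossing_same_block i j xy(1) by blast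
  qed
  have "edge_rep (crossing p) \<phi>"
    unfolding edge_rep_def
  proof (intro conjI allI impI)
    show "card (\<phi> x) = 2" for x by (auto simp: \<phi>_def)
    fix x y :: 'a assume "x \<noteq> y"
    have sym: "crossing p u v \<longleftrightarrow> crossing p v u" for u v
      using sympD[OF symp_crossing[of p]] by blast
    consider "x \<in> {a, b} \<or> y \<in> {a, b}" | "x \<noteq> a" "x \<noteq> b" "y \<noteq> a" "y \<noteq> b" by blast
    then show "crossing p x y \<longleftrightarrow> odd (card (\<phi> x \<inter> \<phi> y))"
    proof cases
      case 1
      then have "crossing p x y"
        using \<open>x \<noteq> y\<close> crossing_a[of x] crossing_a[of y] crossing_b[of x] crossing_b[of y] sym by blast
      moreover have "card (\<phi> x \<inter> \<phi> y) = 1"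
        using 1 \<open>x \<noteq> y\<close> a_neq_b by (auto simp: \<phi>_def Int_insert_left)
      ultimately show ?thesis by simp
    next
      case 2
      have "t x \<noteq> t y" using \<open>x \<noteq> y\<close> t_eq_iff by simp
      then have "odd (card (\<phi> x \<inter> \<phi> y)) \<longleftrightarrow> big x \<and> big y"
        using 2 by (auto simp: \<phi>_def Int_insert_left)
      then show ?thesis using cross[OF \<open>x \<noteq> y\<close> 2] by simp
    qed
  qed
  then show ?thesis by blast
qed

text \<open>Inside the 4-block the two rows force \<open>f w0 = f w2\<close> and
  \<open>f w1 = f w3\<close>. The start of the chain adds \<open>f w0 = f w3\<close>, so four left
  ends share a colour.\<close>

lemma type4_not_small:
  assumes "type_sizes 4 sz"
  shows "\<not> small_vertices p"
proof
  assume "small_vertices p"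
  then obtain f g where col: "vertex_colouring p f g"
    and small: "\<And>k. card {x. t x \<noteq> 1 \<and> f x = k} \<le> 3"
    unfolding small_vertices_def by blast
  obtain i where i: "i < length sz" "sz ! i = 4" and start: "i = 0 \<or> sz ! (i - 1) = 1"
    using type4_chain_start[OF assms] by blast
  let ?u = "ks ! i"
  have u: "2 \<le> ?u" "?u + 4 \<le> CARD('a)"
    using ks_bounds(1)[of i] ks_bounds(2)[of "Suc i"] ks_Suc[OF i(1)] i by auto
  have letter: "\<exists>x. t x = ?u + m \<and> s x + m = ?u + 3" if m: "m < 4" for m
  proof -
    obtain x where x: "t x = ?u + m"
      by (rule row_surj[OF bij_t, of "?u + m"]) (use u m in auto)
    then have "x \<in> block i" using m i ks_Suc[OF i(1)] by (simp add: block_def)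
    then have "s x + m = ?u + 3" using block_sum[OF i(1), of x] ks_Suc[OF i(1)] i(2) x by simp
    then show ?thesis using x by blast
  qed
  obtain w0 where w0: "t w0 = ?u" "s w0 = ?u + 3" using letter[of 0] by auto
  obtain w1 where w1: "t w1 = ?u + 1" "s w1 = ?u + 2" using letter[of 1] by auto
  obtain w2 where w2: "t w2 = ?u + 2" "s w2 = ?u + 1" using letter[of 2] by auto
  obtain w3 where w3: "t w3 = ?u + 3" "s w3 = ?u" using letter[of 3] by auto
  have "f w0 = f w3"
  proof -
    have "\<exists>x y. t x + 1 = ?u \<and> s y + 1 = ?u \<and> g x = g y"
    proof (cases "i = 0")
      \<comment> \<open>Before the first block stand \<open>a\<close> in the top row and
        \<open>b\<close> in the bottom row. Each is last in the other row, so their right ends share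
        a colour.\<close>
      case True
      then show ?thesis
        using ks_0 t_a s_b vertex_colouringD(4)[OF col t_b s_a]
        by (intro exI[of _ a] exI[of _ b]) auto
    next
      case False
      then have j: "i - 1 < length sz" "sz ! (i - 1) = 1" "Suc (i - 1) = i" using start i by auto
      \<comment> \<open>The letter of a 1-block has the same position in both rows, so its right end
        meets \<open>w0\<close> above and \<open>w3\<close> below.\<close>
      then have prev: "ks ! (i - 1) + 1 = ?u" using ks_Suc[OF j(1)] by simp
      obtain x where "x \<in> block (i - 1)" using card_block[OF j(1)] j(2) by (auto simp: card_1_singleton_iff)
      then have "t x + 1 = ?u" "s x + 1 = ?u"
        using block_s[OF j(1)] j(3) prev by (fastforce simp: block_def)+
      then show ?thesis by blast
    qed
    then show ?thesis
      using vertex_colouringD(1)[OF col, of w0] vertex_colouringD(2)[OF col, of w3] w0 w3 by fastforce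
  qed
  moreover have "g w0 = f w1" "g w1 = f w2" "g w2 = f w3"
    using vertex_colouringD(1)[OF col] w0 w1 w2 w3 by simp_all
  moreover have "g w3 = f w2" "g w2 = f w1" "g w1 = f w0"
    using vertex_colouringD(2)[OF col] w0 w1 w2 w3 by simp_all
  ultimately have "{w0, w1, w2, w3} \<subseteq> {x. t x \<noteq> 1 \<and> f x = f w0}"
    using w0 w1 w2 w3 u by auto
  moreover have "card {w0, w1, w2, w3} = 4"
  proof -
    have "distinct [w0, w1, w2, w3]" using w0 w1 w2 w3 by auto
    then show ?thesis using distinct_card by fastforce
  qed
  ultimately have "4 \<le> card {x. t x \<noteq> 1 \<and> f x = f w0}"
    using card_mono[of "{x. t x \<noteq> 1 \<and> f x = f w0}" "{w0, w1, w2, w3}"] by simp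
  then show False using small[of "f w0"] by simp
qed

lemma type5_small:
  assumes "type_sizes 5 sz"
  shows "small_vertices p"
proof -
  note ch = type5_chains[OF assms]
  define L where "L = 0 # gap_colours 0 sz"
  have len: "length L + 1 = CARD('a)"
    using length_gap_colours[OF ch, of 0] ks_eq_sum[of "length sz"] ks_last by (simp add: L_def)
  \<comment> \<open>Gap k lies after position k. The gaps inside the rows are 1, ..., n - 1, hence
    the shift by one. The outer gaps are forced by \<open>a\<close>, which is first above and last
    below: gap 0 is coloured like gap n - 1, and gap n like gap 1.\<close>
  define col where "col k = (if k = 0 then L ! (CARD('a) - 2) else if k = CARD('a) then L ! 0 else L ! (k - 1))" for k
  \<comment> \<open>Because of this agreement a colouring read off the top row also respects the
    adjacencies of the bottom row.\<close>
  have rows: "col (t x - 1) = col (s x - 1) \<and> col (t x) = col (s x)" for x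
  proof -
    consider "x = a" | "x = b" | "x \<noteq> a" "x \<noteq> b" by blast
    then show ?thesis
    proof cases
      case 3
      then obtain i where i: "i < length sz" "x \<in> block i" by (rule inner_block)
      let ?o = "sum_list (take i sz)"
      have ks: "ks ! i = 2 + ?o" "ks ! Suc i = 2 + ?o + sz ! i" "ks ! Suc i \<le> CARD('a)"
        using ks_eq_sum[of i] ks_Suc[OF i(1)] ks_bounds(2)[of "Suc i"] i(1) by simp_all
      define m where "m = t x - ks ! i"
      have m: "m < sz ! i" "t x = 2 + ?o + m" "s x = 2 + ?o + (sz ! i - 1 - m)" "t x < CARD('a)" "s x < CARD('a)"
        using i(2) block_s[OF i] block_sum[OF i] ks by (auto simp: m_def block_def)
      \<comment> \<open>\<open>k\<close> is the offset of \<open>x\<close> within its block in the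
        bottom row.\<close>
      obtain k where k: "sz ! i = m + 1 + k" using m(1) less_iff_Suc_add by auto
      have "L ! (?o + m) = L ! (?o + k)"
        unfolding L_def using gap_colours_symmetric(1)[OF ch i(1) m(1), of 0] by (simp add: k)
      moreover have "L ! (?o + (m + 1)) = L ! (?o + (k + 1))"
        unfolding L_def using gap_colours_symmetric(2)[OF ch i(1), of "m + 1" 0] by (simp add: k)
      ultimately show ?thesis
        using m(2-5) by (simp add: col_def k)
    qed (use t_a t_b s_a s_b card_ge2 in \<open>auto simp: col_def numeral_2_eq_2\<close>)
  qed
  have "vertex_colouring p (\<lambda>x. col (t x - 1)) (\<lambda>x. col (t x))"
    unfolding vertex_colouring_def
  proof (intro conjI ballI allI impI)
    fix r x y assume "r \<in> {t, s}" "r y = Suc (r x)"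
    then show "col (t x) = col (t y - 1)" using rows[of x] rows[of y] by auto
  next
    fix x y assume "t x = 1" "s y = 1"
    then show "col (t x - 1) = col (t y - 1)" using rows[of y] by simp
  next
    fix x y assume "t x = CARD('a)" "s y = CARD('a)"
    then show "col (t x) = col (t y)" using rows[of y] by simp
  qed
  moreover have "card {x. t x \<noteq> 1 \<and> col (t x - 1) = k} \<le> 3" for k
  proof -
    have "inj_on (\<lambda>x. t x - 2) {x. t x \<noteq> 1 \<and> col (t x - 1) = k}"
    proof (rule inj_onI)
      fix x y assume "x \<in> {x. t x \<noteq> 1 \<and> col (t x - 1) = k}" "y \<in> {x. t x \<noteq> 1 \<and> col (t x - 1) = k}"
        "t x - 2 = t y - 2"
      then have "t x = t y" using t_range[of x] t_range[of y] by auto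
      then show "x = y" using t_eq_iff by simp
    qed
    moreover have "(\<lambda>x. t x - 2) ` {x. t x \<noteq> 1 \<and> col (t x - 1) = k} \<subseteq> {i. i < length L \<and> L ! i = k}"
    proof (rule image_subsetI)
      fix x assume x: "x \<in> {x. t x \<noteq> 1 \<and> col (t x - 1) = k}"
      then have "2 \<le> t x" "t x - 1 < CARD('a)" "t x - 1 - 1 = t x - 2" using t_range[of x] by auto
      then show "t x - 2 \<in> {i. i < length L \<and> L ! i = k}" using x len by (auto simp: col_def)
    qed
    ultimately have "card {x. t x \<noteq> 1 \<and> col (t x - 1) = k} \<le> card {i. i < length L \<and> L ! i = k}"
      by (rule card_inj_on_le) simp
    also have "\<dots> = count_list L k"
      by (simp add: count_list_eq_length_filter length_filter_conv_card eq_commute)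
    \<comment> \<open>The head of \<open>L\<close> is one more occurrence of colour 0, which the
      sharper bound 2 for that colour absorbs.\<close>
    also have "\<dots> \<le> 3"
      using gap_colours_count(1)[OF ch, of 0 k] gap_colours_count(2)[OF ch, of 0] by (simp add: L_def)
    finally show ?thesis .
  qed
  ultimately show ?thesis unfolding small_vertices_def by blast
qed

lemma gauss_sum_signs:
  "type_sizes 2 sz \<Longrightarrow> sgn (gauss_sum (crossing p)) = -1"
  "type_sizes 3 sz \<Longrightarrow> sgn (gauss_sum (crossing p)) = 0"
  "type_sizes x sz \<Longrightarrow> x = 4 \<or> x = 5 \<Longrightarrow> sgn (gauss_sum (crossing p)) = 1"
  using sgn_clique_type2 sgn_clique_type3 sgn_clique_type45
  by (simp_all add: gauss_sum_eq sgn_mult sgn_minus)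

end

section \<open>Reading the Type off the invariants\<close>

lemma has_type_por_pair:
  fixes p :: "'a::finite pair"
  assumes "CARD('a) \<ge> 2" "is_pair p" "has_type x p"
  obtains ks where "por_pair p ks" "type_sizes x (block_sizes ks)"
  using assms unfolding has_type_def por_pair_def by blast

definition signature :: "'a::finite pair \<Rightarrow> bool \<times> int \<times> bool" where
  "signature p = (\<exists>\<phi>. edge_rep (crossing p) \<phi>, sgn (gauss_sum (crossing p)), small_vertices p)"

text \<open>The test for Type 1 has to come before the sign: a single block of size 2, 3 or 4
  already gives a negative, zero or positive Gauss sum.\<close>

lemma signature_has_type:
  fixes p :: "'a::finite pair"
  assumes "CARD('a) \<ge> 2" "is_pair p" "has_type x p"
  shows "x = (case signature p of (h, g, v) \<Rightarrow>
    if h then 1 else if g = -1 then 2 else if g = 0 then 3 else if v then 5 else 4)"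
proof -
  obtain ks where ks: "por_pair p ks" "type_sizes x (block_sizes ks)"
    using has_type_por_pair[OF assms] .
  then interpret por_pair p ks by simp
  show ?thesis
  proof (cases rule: type_sizes_cases[OF ks(2)])
    case 1
    then show ?thesis using type1_edge_rep ks(2) by (simp add: signature_def)
  next
    case 2
    then have "\<nexists>\<phi>. edge_rep (crossing p) \<phi>"
      using many_big_blocks_no_edge_rep by blast
    moreover from 2(1) consider "x = 2" | "x = 3" | "x = 4" | "x = 5" by blast
    then have "sgn (gauss_sum (crossing p)) = (if x = 2 then -1 else if x = 3 then 0 else 1)
        \<and> (x = 4 \<longrightarrow> \<not> small_vertices p) \<and> (x = 5 \<longrightarrow> small_vertices p)"
      by cases (use ks(2) gauss_sum_signs(1,2) gauss_sum_signs(3)[of x] type4_not_small type5_small in simp_all)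
    ultimately show ?thesis using 2(1) by (auto simp: signature_def)
  qed
qed

theorem theorem4p7:
  fixes p q :: "'a::finite pair" and x y :: nat
  assumes "CARD('a) \<ge> 2"
    and "is_pair p" and "irreducible_pair p"
    and "has_type x p"
    and "q \<in> ext_rauzy_class p"
    and "has_type y q"
  shows "x = y"
proof -
  note reach = assms(1,2,3,5)
  \<comment> \<open>A constant map is trivially invariant; only the fact about reachable pairs is
    extracted here.\<close>
  have "is_pair q"
    using ext_rauzy_class_invariant(2)[OF reach, of "\<lambda>_. ()"] by simp
  have "(\<exists>\<phi>. edge_rep (crossing q) \<phi>) \<longleftrightarrow> (\<exists>\<phi>. edge_rep (crossing p) \<phi>)"
    by (rule crossing_class_invariant[OF reach]) (rule ex_edge_rep_slide)
  moreover have "gauss_sum (crossing q) = gauss_sum (crossing p)"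
    by (rule crossing_class_invariant[OF reach]) (rule gauss_sum_slide)
  ultimately have "signature q = signature p"
    using small_vertices_class_invariant[OF reach] by (simp add: signature_def)
  then show ?thesis
    using signature_has_type[OF assms(1,2,4)] signature_has_type[OF assms(1) \<open>is_pair q\<close> assms(6)]
    by simp
qed

end
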